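(* Let $A(S^2_\lambda)$ be the algebra of functions on the quantum $2$-sphere. Then $\mathrm{Frac}\,A(S^2_\lambda)\cong\mathrm{Frac}\,\mathbb{C}_\lambda[x,y]$.
   Context: The base field is $\mathbb{C}$. $\lambda\in\mathbb{C}$ is nonzero and not a root of unity, with a fixed square root $\lambda^{1/2}$, and $c,d\in\mathbb{C}$. $A(S^2_\lambda)$ is the quotient of the free algebra $\mathbb{C}\langle X,Y,H\rangle$ by the relations $$XH=\lambda HX,\quad YH=\lambda^{-1}HY,\quad \lambda^{1/2}YX=-(c-H)(d+H),\quad \lambda^{-1/2}XY=-(c-\lambda H)(d+\lambda H).$$ $\mathbb{C}_\lambda[x,y]=\mathbb{C}\langle x,y\mid yx=\lambda xy\rangle$ is the quantum plane, and $\mathrm{Frac}$ denotes the skew field of fractions.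
   Formalization: The relation λ^{-1/2}XY = −(c−λH)(d+λH) is replaced by λ^{1/2}XY = −(c−λH)(d+λH); as printed, associativity forces (c−λH)(d+λH)X = 0, so the quotient is either not a domain or commutative and the claim fails. *)

theory Defs
  imports Complex_Main "HOL-Library.Poly_Mapping" "HOL-Algebra.Module" "HOL-Algebra.QuotRing"
begin

section \<open>Free algebras and algebras given by generators and relations\<close>

text \<open>
  Words in an alphabet, written additively because the convolution product of
  \<^theory>\<open>HOL-Library.Poly_Mapping\<close> expects the exponents to form an additive
  (not necessarily commutative) monoid.
\<close>

datatype 'g fword = FWord (letters: "'g list")

instantiation fword :: (type) monoid_add
begin

definition zero_fword :: "'g fword" where
  "zero_fword = FWord []"

definition plus_fword :: "'g fword \<Rightarrow> 'g fword \<Rightarrow> 'g fword" where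
  "plus_fword v w = FWord (letters v @ letters w)"

instance
  by standard (simp_all add: zero_fword_def plus_fword_def)

end

type_synonym 'g free_alg = "'g fword \<Rightarrow>\<^sub>0 complex"

definition scal :: "complex \<Rightarrow> 'g free_alg" where
  "scal c = Poly_Mapping.single 0 c"

definition gen :: "'g \<Rightarrow> 'g free_alg" where
  "gen g = Poly_Mapping.single (FWord [g]) 1"

text \<open>
  Complex algebras, in general non-commutative, are represented by the record type
  \<^typ>\<open>(complex, 'a) module\<close>, i.e. a ring together with scalar multiplication. (The
  locale \<^locale>\<open>algebra\<close> of the library requires commutativity and is not used.)
\<close>

definition free_algebra :: "(complex, 'g free_alg) module" where
  "free_algebra =
    \<lparr>carrier = UNIV, monoid.mult = (*), one = 1, zero = 0, add = (+),
     smult = (\<lambda>c p. scal c * p)\<rparr>"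

definition quotient_algebra :: "(complex, 'a) module \<Rightarrow> 'a set \<Rightarrow> (complex, 'a set) module" where
  "quotient_algebra A I =
    ring.extend (A Quot I)
      (module.fields (\<lambda>c P. \<Union>p\<in>P. I +>\<^bsub>A\<^esub> (c \<odot>\<^bsub>A\<^esub> p)))"

text \<open>\<^const>\<open>genideal\<close> generates a two-sided ideal.\<close>

definition presented_algebra :: "'g free_alg set \<Rightarrow> (complex, 'g free_alg set) module" where
  "presented_algebra rels = quotient_algebra free_algebra (Idl\<^bsub>free_algebra\<^esub> rels)"

definition algebra_iso :: "(complex, 'a) module \<Rightarrow> (complex, 'b) module \<Rightarrow> ('a \<Rightarrow> 'b) set" where
  "algebra_iso A B =
    {h \<in> ring_iso A B. \<forall>c. \<forall>x \<in> carrier A. h (c \<odot>\<^bsub>A\<^esub> x) = c \<odot>\<^bsub>B\<^esub> h x}"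

definition algebra_isomorphic :: "(complex, 'a) module \<Rightarrow> (complex, 'b) module \<Rightarrow> bool"
    (infix \<open>\<cong>\<^sub>a\<^sub>l\<^sub>g\<close> 60) where
  "A \<cong>\<^sub>a\<^sub>l\<^sub>g B \<longleftrightarrow> algebra_iso A B \<noteq> {}"


section \<open>The skew field of fractions of an Ore domain\<close>

locale right_ore_domain = ring R for R (structure) +
  assumes one_not_zero: "\<one> \<noteq> \<zero>"
    and integral: "\<lbrakk>a \<in> carrier R; b \<in> carrier R; a \<otimes> b = \<zero>\<rbrakk> \<Longrightarrow> a = \<zero> \<or> b = \<zero>"
    and ore: "\<lbrakk>a \<in> carrier R; b \<in> carrier R; a \<noteq> \<zero>; b \<noteq> \<zero>\<rbrakk> \<Longrightarrow>
        \<exists>u\<in>carrier R. \<exists>v\<in>carrier R. a \<otimes> u = b \<otimes> v \<and> a \<otimes> u \<noteq> \<zero>"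

text \<open>
  The pair \<open>(a, s)\<close> stands for the right fraction \<open>a s\<^sup>-\<^sup>1\<close>. Two fractions are equal
  iff they agree after being brought to a common denominator \<open>s u = t v\<close>.
\<close>

definition frac_pairs :: "('a, 'm) ring_scheme \<Rightarrow> ('a \<times> 'a) set" where
  "frac_pairs R = carrier R \<times> (carrier R - {\<zero>\<^bsub>R\<^esub>})"

definition frac_eq :: "('a, 'm) ring_scheme \<Rightarrow> 'a \<times> 'a \<Rightarrow> 'a \<times> 'a \<Rightarrow> bool" where
  "frac_eq R = (\<lambda>(a, s) (b, t). \<exists>u\<in>carrier R. \<exists>v\<in>carrier R.
     s \<otimes>\<^bsub>R\<^esub> u = t \<otimes>\<^bsub>R\<^esub> v \<and> s \<otimes>\<^bsub>R\<^esub> u \<noteq> \<zero>\<^bsub>R\<^esub> \<and> a \<otimes>\<^bsub>R\<^esub> u = b \<otimes>\<^bsub>R\<^esub> v)"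

definition frac :: "('a, 'm) ring_scheme \<Rightarrow> 'a \<Rightarrow> 'a \<Rightarrow> ('a \<times> 'a) set" where
  "frac R a s = {q \<in> frac_pairs R. frac_eq R (a, s) q}"

text \<open>
  Products and sums of fractions:
  \<open>(a s\<^sup>-\<^sup>1) (b t\<^sup>-\<^sup>1) = (a v) (t u)\<^sup>-\<^sup>1\<close> whenever \<open>s v = b u\<close> with \<open>u \<noteq> 0\<close>, and
  \<open>a s\<^sup>-\<^sup>1 + b t\<^sup>-\<^sup>1 = (a u + b v) (s u)\<^sup>-\<^sup>1\<close> whenever \<open>s u = t v \<noteq> 0\<close>.
  As in \<^const>\<open>rcoset_mult\<close>, choices are avoided by taking the union over all
  representatives; over a right Ore domain all the classes in such a union coincide.
\<close>

definition frac_mult ::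
    "('a, 'm) ring_scheme \<Rightarrow> ('a \<times> 'a) set \<Rightarrow> ('a \<times> 'a) set \<Rightarrow> ('a \<times> 'a) set" where
  "frac_mult R P Q = (\<Union>(a, s)\<in>P. \<Union>(b, t)\<in>Q.
     \<Union>{frac R (a \<otimes>\<^bsub>R\<^esub> v) (t \<otimes>\<^bsub>R\<^esub> u) | u v.
        u \<in> carrier R \<and> v \<in> carrier R \<and> u \<noteq> \<zero>\<^bsub>R\<^esub> \<and> s \<otimes>\<^bsub>R\<^esub> v = b \<otimes>\<^bsub>R\<^esub> u})"

definition frac_add ::
    "('a, 'm) ring_scheme \<Rightarrow> ('a \<times> 'a) set \<Rightarrow> ('a \<times> 'a) set \<Rightarrow> ('a \<times> 'a) set" where
  "frac_add R P Q = (\<Union>(a, s)\<in>P. \<Union>(b, t)\<in>Q.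
     \<Union>{frac R (a \<otimes>\<^bsub>R\<^esub> u \<oplus>\<^bsub>R\<^esub> b \<otimes>\<^bsub>R\<^esub> v) (s \<otimes>\<^bsub>R\<^esub> u) | u v.
        u \<in> carrier R \<and> v \<in> carrier R \<and> s \<otimes>\<^bsub>R\<^esub> u = t \<otimes>\<^bsub>R\<^esub> v \<and> s \<otimes>\<^bsub>R\<^esub> u \<noteq> \<zero>\<^bsub>R\<^esub>})"

definition Frac :: "(complex, 'a) module \<Rightarrow> (complex, ('a \<times> 'a) set) module" where
  "Frac A =
    \<lparr>carrier = {frac A a s | a s. (a, s) \<in> frac_pairs A},
     monoid.mult = frac_mult A, one = frac A \<one>\<^bsub>A\<^esub> \<one>\<^bsub>A\<^esub>,
     zero = frac A \<zero>\<^bsub>A\<^esub> \<one>\<^bsub>A\<^esub>, add = frac_add A,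
     smult = (\<lambda>c P. \<Union>(a, s)\<in>P. frac A (c \<odot>\<^bsub>A\<^esub> a) s)\<rparr>"


section \<open>The quantum sphere and the quantum plane\<close>

datatype sphere_gen = X | Y | H

text \<open>
  Here \<open>mu\<close> is the chosen square root of \<open>lam\<close>. The relations for \<open>YX\<close> and \<open>XY\<close> must carry
  the same scalar factor \<open>mu\<close>. With \<open>P(H) = (c - H)(d + H)\<close>, the relation \<open>XH = lam HX\<close> gives
  \<open>X P(H) = P(lam H) X\<close>, so \<open>X(YX) = (XY)X\<close> requires it. If the factor for \<open>XY\<close> were
  \<open>mu\<^sup>-\<^sup>1\<close>, as in the source, then \<open>(mu - mu\<^sup>-\<^sup>1) P(lam H) X = 0\<close>,
  and for \<open>lam \<noteq> 1\<close> the algebra would be commutative as soon as it is a domain. A common factor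
  is only a matter of normalisation, since it can be changed by rescaling \<open>Y\<close>.
\<close>

definition sphere_relations ::
    "complex \<Rightarrow> complex \<Rightarrow> complex \<Rightarrow> complex \<Rightarrow> sphere_gen free_alg set" where
  "sphere_relations lam mu c d =
    {gen X * gen H - scal lam * gen H * gen X,
     gen Y * gen H - scal (inverse lam) * gen H * gen Y,
     scal mu * gen Y * gen X + (scal c - gen H) * (scal d + gen H),
     scal mu * gen X * gen Y +
       (scal c - scal lam * gen H) * (scal d + scal lam * gen H)}"

definition quantum_sphere ::
    "complex \<Rightarrow> complex \<Rightarrow> complex \<Rightarrow> complex \<Rightarrow> (complex, sphere_gen free_alg set) module" where
  "quantum_sphere lam mu c d = presented_algebra (sphere_relations lam mu c d)"

datatype plane_gen = x | y

definition quantum_plane :: "complex \<Rightarrow> (complex, plane_gen free_alg set) module" where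
  "quantum_plane lam = presented_algebra {gen y * gen x - scal lam * gen x * gen y}"

hide_const (open) X Y H x y

end

theory Submission
  imports Defs "HOL-Computational_Algebra.Polynomial"
begin

text \<open>
  The quantum plane and the quantum sphere are subalgebras of one ring. Let operators act on
  sequences of polynomials in a variable \<open>h\<close>: \<open>H\<close> multiplies the \<open>n\<close>-th term by \<open>lam\<^sup>n h\<close>, and \<open>X\<close>
  is the shift, so that \<open>X H = lam H X\<close> and \<open>X\<close> is invertible. Sending \<open>x\<close> to \<open>H\<close> and \<open>y\<close> to \<open>X\<close>
  identifies the quantum plane with the skew polynomials \<open>\<Sum> p\<^sub>j(H) X\<^sup>j\<close>, \<open>j \<ge> 0\<close>. In the sphere the
  relation for \<open>Y X\<close> forces \<open>Y = q(H) X\<^sup>-\<^sup>1\<close> with a nonzero quadratic polynomial \<open>q\<close>, so the sphere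
  becomes an algebra of skew Laurent polynomials that contains the plane. Multiplication by a high
  power of \<open>X\<close>, an element of the plane, takes any element of the sphere into the plane.
  Hence both have the same fractions.

  Three facts make this precise. Both models are faithful (\<open>plane_model\<close>, \<open>sphere_model\<close>): the
  relations rewrite every word into the monomials \<open>H\<^sup>i X\<^sup>j\<close> and, for the sphere, \<open>H\<^sup>i Y\<^sup>j\<close>, and these
  act as independent operators. The skew polynomials form a right Ore domain
  (\<open>skew_mult_nonzero\<close>, \<open>skew_ore\<close>), by leading coefficients and a fraction-free Euclidean algorithm.
  Finally, when every element of a domain \<open>S\<close> can be multiplied on the right by a nonzero element
  of a right Ore subdomain \<open>R\<close> so as to land in \<open>R\<close>, then \<open>S\<close> is a right Ore domain as well and
  the fractions of \<open>S\<close> and \<open>R\<close> agree (\<open>clearing_embedding.Frac_isomorphic\<close>).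
\<close>

section \<open>Fractions over right Ore domains\<close>

context right_ore_domain
begin

lemma mult_nonzero:
  "\<lbrakk>a \<in> carrier R; b \<in> carrier R; a \<noteq> \<zero>; b \<noteq> \<zero>\<rbrakk> \<Longrightarrow> a \<otimes> b \<noteq> \<zero>"
  using integral by blast

lemma left_cancel:
  assumes "s \<otimes> a = s \<otimes> b" "s \<noteq> \<zero>" "s \<in> carrier R" "a \<in> carrier R" "b \<in> carrier R"
  shows "a = b"
proof -
  have "s \<otimes> (a \<ominus> b) = \<zero>"
    using assms by (simp add: minus_eq r_distr r_minus r_neg)
  then have "a \<oplus> \<ominus> b = \<zero>"
    using assms integral[of s "a \<ominus> b"] by (simp add: minus_eq)
  then show ?thesis
    using assms minus_equality[of a "\<ominus> b"] by simp
qed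

lemma right_cancel:
  assumes "a \<otimes> s = b \<otimes> s" "s \<noteq> \<zero>" "s \<in> carrier R" "a \<in> carrier R" "b \<in> carrier R"
  shows "a = b"
proof -
  have "(a \<ominus> b) \<otimes> s = \<zero>"
    using assms by (simp add: minus_eq l_distr l_minus r_neg)
  then have "a \<oplus> \<ominus> b = \<zero>"
    using assms integral[of "a \<ominus> b" s] by (simp add: minus_eq)
  then show ?thesis
    using assms minus_equality[of a "\<ominus> b"] by simp
qed

lemma common_multiple:
  assumes "s \<in> carrier R" "t \<in> carrier R" "s \<noteq> \<zero>" "t \<noteq> \<zero>"
  obtains u v where "u \<in> carrier R" "v \<in> carrier R" "u \<noteq> \<zero>" "v \<noteq> \<zero>"
    "s \<otimes> u = t \<otimes> v" "s \<otimes> u \<noteq> \<zero>"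
  using ore[OF assms] assms by (metis r_null)

text \<open>
  Because \<open>s u\<^sub>0 = t v\<^sub>0\<close> and \<open>s u = t v\<close> have themselves a common multiple, a single
  nonzero common denominator decides equality for all of them. Well-definedness of the operations
  on fractions rests on this passage from some common denominator to every one.
\<close>

lemma frac_eq_all_denominators:
  assumes "frac_eq R (a, s) (b, t)" "(a, s) \<in> frac_pairs R" "(b, t) \<in> frac_pairs R"
    and u: "u \<in> carrier R" and v: "v \<in> carrier R" and uv: "s \<otimes> u = t \<otimes> v"
  shows "a \<otimes> u = b \<otimes> v"
proof -
  have c: "a \<in> carrier R" "b \<in> carrier R" "s \<in> carrier R" "t \<in> carrier R" "s \<noteq> \<zero>" "t \<noteq> \<zero>"
    using assms(2,3) by (auto simp: frac_pairs_def)
  obtain u0 v0 where 0: "u0 \<in> carrier R" "v0 \<in> carrier R" "s \<otimes> u0 = t \<otimes> v0"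
      "s \<otimes> u0 \<noteq> \<zero>" "a \<otimes> u0 = b \<otimes> v0"
    using assms(1) by (auto simp: frac_eq_def)
  show ?thesis
  proof (cases "u = \<zero>")
    case True
    then have "v = \<zero>" using uv c v integral[of t v] by auto
    with True c show ?thesis by simp
  next
    case False
    have "u0 \<noteq> \<zero>" using 0 c by auto
    then obtain p q where pq: "p \<in> carrier R" "q \<in> carrier R" "q \<noteq> \<zero>" "u0 \<otimes> p = u \<otimes> q"
      using common_multiple[of u0 u] 0 u False by metis
    have "t \<otimes> (v0 \<otimes> p) = t \<otimes> (v \<otimes> q)"
      using 0 pq c u v uv by (metis m_assoc)
    then have "v0 \<otimes> p = v \<otimes> q"
      using left_cancel c 0 pq v by (meson m_closed)
    then have "(a \<otimes> u) \<otimes> q = (b \<otimes> v) \<otimes> q"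
      using 0 pq c u v by (metis m_assoc)
    then show ?thesis
      using right_cancel pq c u v by (meson m_closed)
  qed
qed

lemma frac_eq_sym: "frac_eq R p q \<Longrightarrow> frac_eq R q p"
  unfolding frac_eq_def by (cases p; cases q) (auto; metis)

lemma frac_eq_refl: "p \<in> frac_pairs R \<Longrightarrow> frac_eq R p p"
  unfolding frac_eq_def frac_pairs_def by (auto intro!: bexI[of _ \<one>])

lemma frac_eq_trans:
  assumes pq: "frac_eq R p q" and qr: "frac_eq R q r"
    and fp: "p \<in> frac_pairs R" "q \<in> frac_pairs R" "r \<in> frac_pairs R"
  shows "frac_eq R p r"
proof -
  obtain a s b t c w where d: "p = (a, s)" "q = (b, t)" "r = (c, w)"
    by (metis surj_pair)
  have m: "a \<in> carrier R" "b \<in> carrier R" "c \<in> carrier R" "s \<in> carrier R" "t \<in> carrier R"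
      "w \<in> carrier R" "s \<noteq> \<zero>" "t \<noteq> \<zero>" "w \<noteq> \<zero>"
    using fp d by (auto simp: frac_pairs_def)
  obtain u v where uv: "u \<in> carrier R" "v \<in> carrier R" "s \<otimes> u = t \<otimes> v" "s \<otimes> u \<noteq> \<zero>"
    using common_multiple[of s t] m by metis
  obtain e f where ef: "e \<in> carrier R" "f \<in> carrier R" "(s \<otimes> u) \<otimes> e = w \<otimes> f"
      "(s \<otimes> u) \<otimes> e \<noteq> \<zero>"
    using common_multiple[of "s \<otimes> u" w] m uv by (metis m_closed)
  have "a \<otimes> (u \<otimes> e) = b \<otimes> (v \<otimes> e)"
    by (rule frac_eq_all_denominators[of a s b t])
      (use pq fp d m uv ef in \<open>auto simp: m_assoc[symmetric]\<close>)
  moreover have "b \<otimes> (v \<otimes> e) = c \<otimes> f"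
    by (rule frac_eq_all_denominators[of b t c w])
      (use qr fp d m uv ef in \<open>auto simp: m_assoc[symmetric]\<close>)
  moreover have "s \<otimes> (u \<otimes> e) = w \<otimes> f" "s \<otimes> (u \<otimes> e) \<noteq> \<zero>"
    using ef uv(1) m m_assoc[of s u e] by simp_all
  ultimately show ?thesis
    unfolding frac_eq_def d prod.case using uv(1) ef(1,2) by (metis m_closed)
qed

lemma frac_eq_iff_frac:
  assumes "(a, s) \<in> frac_pairs R" "(b, t) \<in> frac_pairs R"
  shows "frac R a s = frac R b t \<longleftrightarrow> frac_eq R (a, s) (b, t)"
proof
  assume "frac R a s = frac R b t"
  moreover have "(b, t) \<in> frac R b t" using assms frac_eq_refl by (simp add: frac_def)
  ultimately show "frac_eq R (a, s) (b, t)" by (auto simp: frac_def)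
next
  assume "frac_eq R (a, s) (b, t)"
  then show "frac R a s = frac R b t"
    unfolding frac_def using assms by (auto intro: frac_eq_trans frac_eq_sym)
qed

lemma frac_eqI:
  assumes "(a, s) \<in> frac_pairs R" "(b, t) \<in> frac_pairs R"
    and "u \<in> carrier R" "v \<in> carrier R" "s \<otimes> u = t \<otimes> v" "s \<otimes> u \<noteq> \<zero>" "a \<otimes> u = b \<otimes> v"
  shows "frac R a s = frac R b t"
proof -
  have "frac_eq R (a, s) (b, t)" unfolding frac_eq_def using assms(3-7) by blast
  then show ?thesis using frac_eq_iff_frac[OF assms(1,2)] by simp
qed

lemma frac_self: "(a, s) \<in> frac_pairs R \<Longrightarrow> (a, s) \<in> frac R a s"
  by (simp add: frac_def frac_eq_refl)

lemma frac_memD: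
  assumes "(b, t) \<in> frac R a s"
  shows "(b, t) \<in> frac_pairs R" "frac_eq R (a, s) (b, t)"
  using assms by (auto simp: frac_def)

lemma frac_expand:
  assumes "(a, s) \<in> frac_pairs R" "w \<in> carrier R" "w \<noteq> \<zero>"
  shows "frac R (a \<otimes> w) (s \<otimes> w) = frac R a s"
proof -
  have m: "a \<in> carrier R" "s \<in> carrier R" "s \<noteq> \<zero>"
    using assms by (auto simp: frac_pairs_def)
  show ?thesis
    using assms m mult_nonzero[of s w]
    by (intro frac_eqI[of _ _ _ _ \<one> w]) (auto simp: frac_pairs_def)
qed

lemma numerator_multiple:
  assumes "s \<in> carrier R" "b \<in> carrier R" "s \<noteq> \<zero>"
  obtains u v where "u \<in> carrier R" "v \<in> carrier R" "u \<noteq> \<zero>" "s \<otimes> v = b \<otimes> u"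
proof (cases "b = \<zero>")
  case True
  then show ?thesis using assms one_not_zero that[of \<one> \<zero>] by simp
next
  case False
  then show ?thesis using common_multiple[of s b] assms that by metis
qed

text \<open>
  For two choices of representatives, multiply \<open>t u\<close> and \<open>t' u'\<close> up to a common multiple
  \<open>t u f = t' u' e\<close>. Equality of the second factors gives \<open>b u f = b' u' e\<close>, that is
  \<open>s v f = s' v' e\<close>, and then equality of the first factors gives \<open>a v f = a' v' e\<close>.
\<close>

lemma frac_mult_eq:
  assumes p: "(a, s) \<in> frac_pairs R" "(b, t) \<in> frac_pairs R"
    and uv: "u \<in> carrier R" "v \<in> carrier R" "u \<noteq> \<zero>" "s \<otimes> v = b \<otimes> u"
  shows "frac_mult R (frac R a s) (frac R b t) = frac R (a \<otimes> v) (t \<otimes> u)"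
proof -
  have m: "a \<in> carrier R" "s \<in> carrier R" "s \<noteq> \<zero>" "b \<in> carrier R" "t \<in> carrier R" "t \<noteq> \<zero>"
    using p by (auto simp: frac_pairs_def)
  have indep: "frac R (a' \<otimes> v') (t' \<otimes> u') = frac R (a \<otimes> v) (t \<otimes> u)"
    if as: "(a', s') \<in> frac R a s" and bt: "(b', t') \<in> frac R b t"
      and uv': "u' \<in> carrier R" "v' \<in> carrier R" "u' \<noteq> \<zero>" "s' \<otimes> v' = b' \<otimes> u'"
    for a' s' b' t' u' v'
  proof -
    have m': "a' \<in> carrier R" "s' \<in> carrier R" "s' \<noteq> \<zero>" "b' \<in> carrier R" "t' \<in> carrier R"
        "t' \<noteq> \<zero>"
      using as bt by (auto simp: frac_pairs_def frac_def)
    have nz: "t \<otimes> u \<noteq> \<zero>" "t' \<otimes> u' \<noteq> \<zero>"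
      using m m' uv uv' mult_nonzero by auto
    obtain e f where ef: "e \<in> carrier R" "f \<in> carrier R" "(t' \<otimes> u') \<otimes> e = (t \<otimes> u) \<otimes> f"
        "(t' \<otimes> u') \<otimes> e \<noteq> \<zero>"
      using common_multiple[of "t' \<otimes> u'" "t \<otimes> u"] m m' uv uv' nz by (metis m_closed)
    have "b \<otimes> (u \<otimes> f) = b' \<otimes> (u' \<otimes> e)"
      by (rule frac_eq_all_denominators[of b t b' t'])
        (use bt p m m' uv uv' ef in \<open>auto simp: m_assoc[symmetric] frac_def\<close>)
    then have *: "s \<otimes> (v \<otimes> f) = s' \<otimes> (v' \<otimes> e)"
      using m m' uv uv' ef by (metis m_assoc)
    have "a \<otimes> (v \<otimes> f) = a' \<otimes> (v' \<otimes> e)"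
      by (rule frac_eq_all_denominators[of a s a' s'])
        (use as p m m' uv uv' ef * in \<open>auto simp: frac_def\<close>)
    then show ?thesis
      using m m' uv uv' ef nz
      by (intro frac_eqI[of _ _ _ _ e f]) (auto simp: frac_pairs_def m_assoc)
  qed
  show ?thesis
  proof
    show "frac_mult R (frac R a s) (frac R b t) \<subseteq> frac R (a \<otimes> v) (t \<otimes> u)"
      unfolding frac_mult_def using indep by blast
    show "frac R (a \<otimes> v) (t \<otimes> u) \<subseteq> frac_mult R (frac R a s) (frac R b t)"
      unfolding frac_mult_def using frac_self[OF p(1)] frac_self[OF p(2)] uv by blast
  qed
qed

lemma frac_add_eq:
  assumes p: "(a, s) \<in> frac_pairs R" "(b, t) \<in> frac_pairs R"
    and uv: "u \<in> carrier R" "v \<in> carrier R" "s \<otimes> u = t \<otimes> v" "s \<otimes> u \<noteq> \<zero>"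
  shows "frac_add R (frac R a s) (frac R b t) = frac R (a \<otimes> u \<oplus> b \<otimes> v) (s \<otimes> u)"
proof -
  have m: "a \<in> carrier R" "s \<in> carrier R" "s \<noteq> \<zero>" "b \<in> carrier R" "t \<in> carrier R" "t \<noteq> \<zero>"
    using p by (auto simp: frac_pairs_def)
  have indep: "frac R (a' \<otimes> u' \<oplus> b' \<otimes> v') (s' \<otimes> u') = frac R (a \<otimes> u \<oplus> b \<otimes> v) (s \<otimes> u)"
    if as: "(a', s') \<in> frac R a s" and bt: "(b', t') \<in> frac R b t"
      and uv': "u' \<in> carrier R" "v' \<in> carrier R" "s' \<otimes> u' = t' \<otimes> v'" "s' \<otimes> u' \<noteq> \<zero>"
    for a' s' b' t' u' v'
  proof -
    have m': "a' \<in> carrier R" "s' \<in> carrier R" "s' \<noteq> \<zero>" "b' \<in> carrier R" "t' \<in> carrier R"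
        "t' \<noteq> \<zero>"
      using as bt by (auto simp: frac_pairs_def frac_def)
    obtain e f where ef: "e \<in> carrier R" "f \<in> carrier R" "(s' \<otimes> u') \<otimes> e = (s \<otimes> u) \<otimes> f"
        "(s' \<otimes> u') \<otimes> e \<noteq> \<zero>"
      using common_multiple[of "s' \<otimes> u'" "s \<otimes> u"] m m' uv uv' by (metis m_closed)
    have "a \<otimes> (u \<otimes> f) = a' \<otimes> (u' \<otimes> e)"
      by (rule frac_eq_all_denominators[of a s a' s'])
        (use as p m m' uv uv' ef in \<open>auto simp: m_assoc[symmetric] frac_def\<close>)
    moreover have "b \<otimes> (v \<otimes> f) = b' \<otimes> (v' \<otimes> e)"
      by (rule frac_eq_all_denominators[of b t b' t'])
        (use bt p m m' uv uv' ef in \<open>auto simp: m_assoc[symmetric] frac_def\<close>)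
    ultimately show ?thesis
      using m m' uv uv' ef
      by (intro frac_eqI[of _ _ _ _ e f]) (auto simp: frac_pairs_def m_assoc l_distr)
  qed
  show ?thesis
  proof
    show "frac_add R (frac R a s) (frac R b t) \<subseteq> frac R (a \<otimes> u \<oplus> b \<otimes> v) (s \<otimes> u)"
      unfolding frac_add_def using indep by blast
    show "frac R (a \<otimes> u \<oplus> b \<otimes> v) (s \<otimes> u) \<subseteq> frac_add R (frac R a s) (frac R b t)"
      unfolding frac_add_def using frac_self[OF p(1)] frac_self[OF p(2)] uv by blast
  qed
qed

end

lemma frac_smult_eq:
  fixes A :: "(complex, 'a) module"
  assumes "right_ore_domain A"
    and p: "(a, s) \<in> frac_pairs A"
    and closed: "\<And>a. a \<in> carrier A \<Longrightarrow> c \<odot>\<^bsub>A\<^esub> a \<in> carrier A"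
    and assoc: "\<And>a b. \<lbrakk>a \<in> carrier A; b \<in> carrier A\<rbrakk> \<Longrightarrow>
        (c \<odot>\<^bsub>A\<^esub> a) \<otimes>\<^bsub>A\<^esub> b = c \<odot>\<^bsub>A\<^esub> (a \<otimes>\<^bsub>A\<^esub> b)"
  shows "c \<odot>\<^bsub>Frac A\<^esub> frac A a s = frac A (c \<odot>\<^bsub>A\<^esub> a) s"
proof -
  interpret right_ore_domain A by fact
  have indep: "frac A (c \<odot>\<^bsub>A\<^esub> b) t = frac A (c \<odot>\<^bsub>A\<^esub> a) s" if bt: "(b, t) \<in> frac A a s" for b t
  proof -
    have "frac_eq A (a, s) (b, t)" "(b, t) \<in> frac_pairs A" using frac_memD[OF bt] by auto
    then obtain u v where
      "u \<in> carrier A" "v \<in> carrier A" "s \<otimes>\<^bsub>A\<^esub> u = t \<otimes>\<^bsub>A\<^esub> v" "s \<otimes>\<^bsub>A\<^esub> u \<noteq> \<zero>\<^bsub>A\<^esub>"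
      "a \<otimes>\<^bsub>A\<^esub> u = b \<otimes>\<^bsub>A\<^esub> v"
      by (auto simp: frac_eq_def)
    with p \<open>(b, t) \<in> frac_pairs A\<close> show ?thesis
      by (intro frac_eqI[of _ _ _ _ v u]) (auto simp: frac_pairs_def closed assoc)
  qed
  show ?thesis
  proof
    show "c \<odot>\<^bsub>Frac A\<^esub> frac A a s \<subseteq> frac A (c \<odot>\<^bsub>A\<^esub> a) s"
      using indep by (auto simp: Frac_def)
    show "frac A (c \<odot>\<^bsub>A\<^esub> a) s \<subseteq> c \<odot>\<^bsub>Frac A\<^esub> frac A a s"
      using frac_self[OF p] by (auto simp: Frac_def)
  qed
qed

section \<open>Subalgebras that contain a denominator of every element\<close>

text \<open>
  Every element of \<open>S\<close> is a fraction \<open>\<phi>(r') \<phi>(r)\<^sup>-\<^sup>1\<close> with \<open>r\<close> and \<open>r'\<close> in \<open>R\<close>: the algebra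
  \<open>S\<close> lies between \<open>R\<close> and its skew field of fractions, so passing to fractions adds the same
  elements to both.
\<close>

locale clearing_embedding =
  R: right_ore_domain R + S: ring S
  for R :: "(complex, 'a) module" (structure) and S :: "(complex, 'b) module" (structure) +
  fixes \<phi> :: "'a \<Rightarrow> 'b"
  assumes hom: "\<phi> \<in> ring_hom R S"
    and inj: "inj_on \<phi> (carrier R)"
    and S_integral: "\<And>a b. \<lbrakk>a \<in> carrier S; b \<in> carrier S; a \<otimes>\<^bsub>S\<^esub> b = \<zero>\<^bsub>S\<^esub>\<rbrakk> \<Longrightarrow> a = \<zero>\<^bsub>S\<^esub> \<or> b = \<zero>\<^bsub>S\<^esub>"
    and clear: "\<And>a. a \<in> carrier S \<Longrightarrow>
        \<exists>r\<in>carrier R. r \<noteq> \<zero>\<^bsub>R\<^esub> \<and> a \<otimes>\<^bsub>S\<^esub> \<phi> r \<in> \<phi> ` carrier R"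
    and R_smult_closed: "\<And>c a. a \<in> carrier R \<Longrightarrow> c \<odot>\<^bsub>R\<^esub> a \<in> carrier R"
    and R_smult_assoc: "\<And>c a a'. \<lbrakk>a \<in> carrier R; a' \<in> carrier R\<rbrakk> \<Longrightarrow>
        (c \<odot>\<^bsub>R\<^esub> a) \<otimes>\<^bsub>R\<^esub> a' = c \<odot>\<^bsub>R\<^esub> (a \<otimes>\<^bsub>R\<^esub> a')"
    and S_smult_closed: "\<And>c b. b \<in> carrier S \<Longrightarrow> c \<odot>\<^bsub>S\<^esub> b \<in> carrier S"
    and S_smult_assoc: "\<And>c b b'. \<lbrakk>b \<in> carrier S; b' \<in> carrier S\<rbrakk> \<Longrightarrow>
        (c \<odot>\<^bsub>S\<^esub> b) \<otimes>\<^bsub>S\<^esub> b' = c \<odot>\<^bsub>S\<^esub> (b \<otimes>\<^bsub>S\<^esub> b')"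
    and smult: "\<And>c a. a \<in> carrier R \<Longrightarrow> \<phi> (c \<odot>\<^bsub>R\<^esub> a) = c \<odot>\<^bsub>S\<^esub> \<phi> a"
begin

lemmas hom_mult = ring_hom_mult[OF hom]
lemmas hom_add = ring_hom_add[OF hom]
lemmas hom_closed = ring_hom_closed[OF hom]
lemmas hom_one = ring_hom_one[OF hom]

lemma hom_zero: "\<phi> \<zero>\<^bsub>R\<^esub> = \<zero>\<^bsub>S\<^esub>"
  using ring_hom_zero[OF hom] R.ring_axioms S.ring_axioms by blast

lemma hom_eq_zero_iff: "a \<in> carrier R \<Longrightarrow> \<phi> a = \<zero>\<^bsub>S\<^esub> \<longleftrightarrow> a = \<zero>\<^bsub>R\<^esub>"
  using inj hom_zero R.zero_closed by (metis inj_onD)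

text \<open>
  To find a common right multiple of \<open>a\<close> and \<open>b\<close> in \<open>S\<close>, multiply both into \<open>R\<close> from the right
  and use the Ore condition there.
\<close>

lemma S_right_ore_domain: "right_ore_domain S"
proof (unfold_locales)
  show "\<one>\<^bsub>S\<^esub> \<noteq> \<zero>\<^bsub>S\<^esub>"
    using hom_eq_zero_iff[of "\<one>\<^bsub>R\<^esub>"] hom_one R.one_not_zero by auto
next
  fix a b assume ab: "a \<in> carrier S" "b \<in> carrier S" "a \<noteq> \<zero>\<^bsub>S\<^esub>" "b \<noteq> \<zero>\<^bsub>S\<^esub>"
  obtain r a' where r: "r \<in> carrier R" "r \<noteq> \<zero>\<^bsub>R\<^esub>" "a' \<in> carrier R" "a \<otimes>\<^bsub>S\<^esub> \<phi> r = \<phi> a'"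
    using clear[OF ab(1)] by auto
  obtain q b' where q: "q \<in> carrier R" "q \<noteq> \<zero>\<^bsub>R\<^esub>" "b' \<in> carrier R" "b \<otimes>\<^bsub>S\<^esub> \<phi> q = \<phi> b'"
    using clear[OF ab(2)] by auto
  have "\<phi> a' \<noteq> \<zero>\<^bsub>S\<^esub>" "\<phi> b' \<noteq> \<zero>\<^bsub>S\<^esub>"
    using ab r q S_integral[of a "\<phi> r"] S_integral[of b "\<phi> q"] by (auto simp: hom_closed hom_eq_zero_iff)
  then have "a' \<noteq> \<zero>\<^bsub>R\<^esub>" "b' \<noteq> \<zero>\<^bsub>R\<^esub>" using hom_zero by auto
  then obtain u v where uv: "u \<in> carrier R" "v \<in> carrier R" "a' \<otimes>\<^bsub>R\<^esub> u = b' \<otimes>\<^bsub>R\<^esub> v"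
      "a' \<otimes>\<^bsub>R\<^esub> u \<noteq> \<zero>\<^bsub>R\<^esub>"
    using R.common_multiple[of a' b'] r(3) q(3) by metis
  have "a \<otimes>\<^bsub>S\<^esub> \<phi> (r \<otimes>\<^bsub>R\<^esub> u) = \<phi> (a' \<otimes>\<^bsub>R\<^esub> u)" "b \<otimes>\<^bsub>S\<^esub> \<phi> (q \<otimes>\<^bsub>R\<^esub> v) = \<phi> (b' \<otimes>\<^bsub>R\<^esub> v)"
    using r q uv(1,2) ab by (simp_all add: hom_mult hom_closed S.m_assoc[symmetric])
  moreover have "\<phi> (a' \<otimes>\<^bsub>R\<^esub> u) \<noteq> \<zero>\<^bsub>S\<^esub>"
    using uv r q(3) by (simp add: hom_eq_zero_iff)
  ultimately show "\<exists>u\<in>carrier S. \<exists>v\<in>carrier S. a \<otimes>\<^bsub>S\<^esub> u = b \<otimes>\<^bsub>S\<^esub> v \<and> a \<otimes>\<^bsub>S\<^esub> u \<noteq> \<zero>\<^bsub>S\<^esub>"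
    using uv(1-3) r(1) q(1)
    by (intro bexI[of _ "\<phi> (r \<otimes>\<^bsub>R\<^esub> u)"] bexI[of _ "\<phi> (q \<otimes>\<^bsub>R\<^esub> v)"]) (simp_all add: hom_closed)
qed (use S_integral in auto)

sublocale S: right_ore_domain S by (rule S_right_ore_domain)

lemma hom_frac_pairs: "(a, s) \<in> frac_pairs R \<Longrightarrow> (\<phi> a, \<phi> s) \<in> frac_pairs S"
  by (auto simp: frac_pairs_def hom_closed hom_eq_zero_iff)

lemma frac_eq_hom_iff:
  assumes "(a, s) \<in> frac_pairs R" "(b, t) \<in> frac_pairs R"
  shows "frac_eq S (\<phi> a, \<phi> s) (\<phi> b, \<phi> t) \<longleftrightarrow> frac_eq R (a, s) (b, t)"
proof -
  have m: "a \<in> carrier R" "b \<in> carrier R" "s \<in> carrier R" "t \<in> carrier R"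
      "s \<noteq> \<zero>\<^bsub>R\<^esub>" "t \<noteq> \<zero>\<^bsub>R\<^esub>"
    using assms by (auto simp: frac_pairs_def)
  show ?thesis
  proof
    assume eq: "frac_eq S (\<phi> a, \<phi> s) (\<phi> b, \<phi> t)"
    obtain u v where uv: "u \<in> carrier R" "v \<in> carrier R" "s \<otimes>\<^bsub>R\<^esub> u = t \<otimes>\<^bsub>R\<^esub> v"
        "s \<otimes>\<^bsub>R\<^esub> u \<noteq> \<zero>\<^bsub>R\<^esub>"
      using R.common_multiple[of s t] m(3-6) by metis
    have "\<phi> s \<otimes>\<^bsub>S\<^esub> \<phi> u = \<phi> t \<otimes>\<^bsub>S\<^esub> \<phi> v"
      using uv(1-3) m(3,4) by (simp add: hom_mult[symmetric])
    then have "\<phi> a \<otimes>\<^bsub>S\<^esub> \<phi> u = \<phi> b \<otimes>\<^bsub>S\<^esub> \<phi> v"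
      using S.frac_eq_all_denominators[OF eq] assms uv by (simp add: hom_frac_pairs hom_closed)
    then have "a \<otimes>\<^bsub>R\<^esub> u = b \<otimes>\<^bsub>R\<^esub> v"
      using uv m inj by (simp add: hom_mult[symmetric] inj_on_eq_iff)
    then show "frac_eq R (a, s) (b, t)"
      unfolding frac_eq_def prod.case using uv by blast
  next
    assume "frac_eq R (a, s) (b, t)"
    then obtain u v where uv: "u \<in> carrier R" "v \<in> carrier R" "s \<otimes>\<^bsub>R\<^esub> u = t \<otimes>\<^bsub>R\<^esub> v"
        "s \<otimes>\<^bsub>R\<^esub> u \<noteq> \<zero>\<^bsub>R\<^esub>" "a \<otimes>\<^bsub>R\<^esub> u = b \<otimes>\<^bsub>R\<^esub> v"
      by (auto simp: frac_eq_def)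
    then have "\<phi> s \<otimes>\<^bsub>S\<^esub> \<phi> u = \<phi> t \<otimes>\<^bsub>S\<^esub> \<phi> v" "\<phi> s \<otimes>\<^bsub>S\<^esub> \<phi> u \<noteq> \<zero>\<^bsub>S\<^esub>"
      "\<phi> a \<otimes>\<^bsub>S\<^esub> \<phi> u = \<phi> b \<otimes>\<^bsub>S\<^esub> \<phi> v"
      using m by (simp_all add: hom_mult[symmetric] hom_eq_zero_iff)
    then show "frac_eq S (\<phi> a, \<phi> s) (\<phi> b, \<phi> t)"
      unfolding frac_eq_def prod.case using hom_closed[OF uv(1)] hom_closed[OF uv(2)] by blast
  qed
qed

text \<open>
  Clearing first the denominator \<open>s\<close> and then the numerator \<open>a\<close> rewrites \<open>a s\<^sup>-\<^sup>1\<close>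
  with both entries in \<open>R\<close>.
\<close>

lemma frac_S_cases:
  assumes "P \<in> carrier (Frac S)"
  obtains a s where "(a, s) \<in> frac_pairs R" "P = frac S (\<phi> a) (\<phi> s)"
proof -
  obtain a s where P: "(a, s) \<in> frac_pairs S" "P = frac S a s"
    using assms by (auto simp: Frac_def)
  then have m: "a \<in> carrier S" "s \<in> carrier S" "s \<noteq> \<zero>\<^bsub>S\<^esub>" by (auto simp: frac_pairs_def)
  obtain r s' where r: "r \<in> carrier R" "r \<noteq> \<zero>\<^bsub>R\<^esub>" "s' \<in> carrier R" "s \<otimes>\<^bsub>S\<^esub> \<phi> r = \<phi> s'"
    using clear[OF m(2)] by auto
  obtain q a' where q: "q \<in> carrier R" "q \<noteq> \<zero>\<^bsub>R\<^esub>" "a' \<in> carrier R"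
      "(a \<otimes>\<^bsub>S\<^esub> \<phi> r) \<otimes>\<^bsub>S\<^esub> \<phi> q = \<phi> a'"
    using clear[of "a \<otimes>\<^bsub>S\<^esub> \<phi> r"] m r by (auto simp: hom_closed)
  let ?w = "\<phi> r \<otimes>\<^bsub>S\<^esub> \<phi> q"
  have w: "?w \<in> carrier S" "?w \<noteq> \<zero>\<^bsub>S\<^esub>"
    using r q by (auto simp: hom_closed hom_eq_zero_iff S.mult_nonzero)
  have s: "s \<otimes>\<^bsub>S\<^esub> ?w = \<phi> (s' \<otimes>\<^bsub>R\<^esub> q)"
    using m r q by (simp add: hom_mult hom_closed S.m_assoc[symmetric])
  have a: "a \<otimes>\<^bsub>S\<^esub> ?w = \<phi> a'"
    using m r q by (simp add: hom_closed S.m_assoc[symmetric])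
  have "s' \<otimes>\<^bsub>R\<^esub> q \<noteq> \<zero>\<^bsub>R\<^esub>"
    using s S.mult_nonzero[OF m(2) w(1) m(3) w(2)] hom_zero by auto
  moreover have "P = frac S (\<phi> a') (\<phi> (s' \<otimes>\<^bsub>R\<^esub> q))"
    using S.frac_expand[OF P(1) w] P(2) s a by simp
  ultimately show ?thesis
    using that[of a' "s' \<otimes>\<^bsub>R\<^esub> q"] r q by (simp add: frac_pairs_def)
qed

text \<open>Restricting a class of pairs in \<open>S\<close> along \<open>\<phi>\<close> inverts \<open>a s\<^sup>-\<^sup>1 \<mapsto> \<phi>(a) \<phi>(s)\<^sup>-\<^sup>1\<close> without
  any choice of representatives.\<close>

definition restrict_frac :: "('b \<times> 'b) set \<Rightarrow> ('a \<times> 'a) set" where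
  "restrict_frac P = {(a, s) \<in> frac_pairs R. (\<phi> a, \<phi> s) \<in> P}"

lemma restrict_frac_hom:
  assumes "(a, s) \<in> frac_pairs R"
  shows "restrict_frac (frac S (\<phi> a) (\<phi> s)) = frac R a s"
  using assms by (auto simp: restrict_frac_def frac_def hom_frac_pairs frac_eq_hom_iff)

lemma frac_hom_eq_iff:
  assumes "(a, s) \<in> frac_pairs R" "(b, t) \<in> frac_pairs R"
  shows "frac S (\<phi> a) (\<phi> s) = frac S (\<phi> b) (\<phi> t) \<longleftrightarrow> frac R a s = frac R b t"
  using assms by (simp add: R.frac_eq_iff_frac S.frac_eq_iff_frac hom_frac_pairs frac_eq_hom_iff)

lemma Frac_isomorphic: "Frac S \<cong>\<^sub>a\<^sub>l\<^sub>g Frac R"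
proof -
  have "restrict_frac \<in> ring_hom (Frac S) (Frac R)"
  proof (rule ring_hom_memI)
    fix P assume "P \<in> carrier (Frac S)"
    then show "restrict_frac P \<in> carrier (Frac R)"
      by (elim frac_S_cases) (auto simp: restrict_frac_hom Frac_def)
  next
    fix P Q assume PQ: "P \<in> carrier (Frac S)" "Q \<in> carrier (Frac S)"
    obtain a s where P: "(a, s) \<in> frac_pairs R" "P = frac S (\<phi> a) (\<phi> s)"
      using frac_S_cases[OF PQ(1)] by blast
    obtain b t where Q: "(b, t) \<in> frac_pairs R" "Q = frac S (\<phi> b) (\<phi> t)"
      using frac_S_cases[OF PQ(2)] by blast
    have m: "a \<in> carrier R" "s \<in> carrier R" "s \<noteq> \<zero>\<^bsub>R\<^esub>" "b \<in> carrier R" "t \<in> carrier R"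
        "t \<noteq> \<zero>\<^bsub>R\<^esub>"
      using P Q by (auto simp: frac_pairs_def)
    note pairs = P(1) Q(1) hom_frac_pairs[OF P(1)] hom_frac_pairs[OF Q(1)]
    obtain u v where uv: "u \<in> carrier R" "v \<in> carrier R" "u \<noteq> \<zero>\<^bsub>R\<^esub>" "s \<otimes>\<^bsub>R\<^esub> v = b \<otimes>\<^bsub>R\<^esub> u"
      using R.numerator_multiple[of s b] m(2-4) by metis
    have "\<phi> s \<otimes>\<^bsub>S\<^esub> \<phi> v = \<phi> b \<otimes>\<^bsub>S\<^esub> \<phi> u"
      using uv m by (simp add: hom_mult[symmetric])
    then have "frac_mult S P Q = frac S (\<phi> (a \<otimes>\<^bsub>R\<^esub> v)) (\<phi> (t \<otimes>\<^bsub>R\<^esub> u))"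
      using S.frac_mult_eq[OF pairs(3,4), of "\<phi> u" "\<phi> v"] uv P Q m
      by (simp add: hom_closed hom_eq_zero_iff hom_mult)
    moreover have "(a \<otimes>\<^bsub>R\<^esub> v, t \<otimes>\<^bsub>R\<^esub> u) \<in> frac_pairs R"
      using m uv by (auto simp: frac_pairs_def R.mult_nonzero)
    ultimately show "restrict_frac (P \<otimes>\<^bsub>Frac S\<^esub> Q) = restrict_frac P \<otimes>\<^bsub>Frac R\<^esub> restrict_frac Q"
      using R.frac_mult_eq[OF pairs(1,2) uv] P Q by (simp add: restrict_frac_hom Frac_def)
    obtain u v where uv: "u \<in> carrier R" "v \<in> carrier R" "s \<otimes>\<^bsub>R\<^esub> u = t \<otimes>\<^bsub>R\<^esub> v"
        "s \<otimes>\<^bsub>R\<^esub> u \<noteq> \<zero>\<^bsub>R\<^esub>"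
      using R.common_multiple[of s t] m(2,3,5,6) by metis
    have "\<phi> s \<otimes>\<^bsub>S\<^esub> \<phi> u = \<phi> t \<otimes>\<^bsub>S\<^esub> \<phi> v" "\<phi> s \<otimes>\<^bsub>S\<^esub> \<phi> u \<noteq> \<zero>\<^bsub>S\<^esub>"
      using uv m by (simp_all add: hom_mult[symmetric] hom_eq_zero_iff)
    then have "frac_add S P Q = frac S (\<phi> (a \<otimes>\<^bsub>R\<^esub> u \<oplus>\<^bsub>R\<^esub> b \<otimes>\<^bsub>R\<^esub> v)) (\<phi> (s \<otimes>\<^bsub>R\<^esub> u))"
      using S.frac_add_eq[OF pairs(3,4), of "\<phi> u" "\<phi> v"] uv P Q m
      by (simp add: hom_closed hom_mult hom_add)
    moreover have "(a \<otimes>\<^bsub>R\<^esub> u \<oplus>\<^bsub>R\<^esub> b \<otimes>\<^bsub>R\<^esub> v, s \<otimes>\<^bsub>R\<^esub> u) \<in> frac_pairs R"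
      using m uv by (auto simp: frac_pairs_def)
    ultimately show "restrict_frac (P \<oplus>\<^bsub>Frac S\<^esub> Q) = restrict_frac P \<oplus>\<^bsub>Frac R\<^esub> restrict_frac Q"
      using R.frac_add_eq[OF pairs(1,2) uv] P Q by (simp add: restrict_frac_hom Frac_def)
  next
    show "restrict_frac \<one>\<^bsub>Frac S\<^esub> = \<one>\<^bsub>Frac R\<^esub>"
      using restrict_frac_hom[of "\<one>\<^bsub>R\<^esub>" "\<one>\<^bsub>R\<^esub>"] R.one_not_zero
      by (simp add: Frac_def frac_pairs_def hom_one)
  qed
  moreover have "bij_betw restrict_frac (carrier (Frac S)) (carrier (Frac R))"
    unfolding bij_betw_def
  proof
    show "inj_on restrict_frac (carrier (Frac S))"
      by (rule inj_onI, elim frac_S_cases) (simp add: restrict_frac_hom frac_hom_eq_iff)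
    show "restrict_frac ` carrier (Frac S) = carrier (Frac R)"
    proof
      show "restrict_frac ` carrier (Frac S) \<subseteq> carrier (Frac R)"
        by (rule image_subsetI, elim frac_S_cases) (auto simp: restrict_frac_hom Frac_def)
      show "carrier (Frac R) \<subseteq> restrict_frac ` carrier (Frac S)"
      proof
        fix P assume "P \<in> carrier (Frac R)"
        then obtain a s where "(a, s) \<in> frac_pairs R" "P = frac R a s"
          by (auto simp: Frac_def)
        then show "P \<in> restrict_frac ` carrier (Frac S)"
          using hom_frac_pairs[of a s] restrict_frac_hom[of a s]
          by (auto simp: Frac_def intro!: image_eqI[of _ _ "frac S (\<phi> a) (\<phi> s)"])
      qed
    qed
  qed
  moreover have "restrict_frac (c \<odot>\<^bsub>Frac S\<^esub> P) = c \<odot>\<^bsub>Frac R\<^esub> restrict_frac P"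
    if carr: "P \<in> carrier (Frac S)" for c P
  proof -
    obtain a s where P: "(a, s) \<in> frac_pairs R" "P = frac S (\<phi> a) (\<phi> s)"
      using frac_S_cases[OF carr] by blast
    then have "(c \<odot>\<^bsub>R\<^esub> a, s) \<in> frac_pairs R" "a \<in> carrier R"
      by (auto simp: frac_pairs_def R_smult_closed)
    moreover have "c \<odot>\<^bsub>Frac S\<^esub> P = frac S (\<phi> (c \<odot>\<^bsub>R\<^esub> a)) (\<phi> s)"
      using frac_smult_eq[OF S_right_ore_domain hom_frac_pairs[OF P(1)], of c] P \<open>a \<in> carrier R\<close>
      by (simp add: S_smult_closed S_smult_assoc smult)
    moreover have "c \<odot>\<^bsub>Frac R\<^esub> frac R a s = frac R (c \<odot>\<^bsub>R\<^esub> a) s"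
      using frac_smult_eq[OF R.right_ore_domain_axioms P(1), of c]
      by (simp add: R_smult_closed R_smult_assoc)
    ultimately show ?thesis
      using P by (simp add: restrict_frac_hom)
  qed
  ultimately show ?thesis
    unfolding algebra_isomorphic_def algebra_iso_def ring_iso_def by blast
qed

end

section \<open>Faithful models of presented algebras\<close>

lemma ring_free_algebra: "ring free_algebra"
proof (rule ringI)
  show "abelian_group (free_algebra :: (complex, 'a free_alg) module)"
  proof (rule abelian_groupI)
    fix p assume "p \<in> carrier (free_algebra :: (complex, 'a free_alg) module)"
    show "\<exists>q\<in>carrier free_algebra. q \<oplus>\<^bsub>free_algebra\<^esub> p = \<zero>\<^bsub>free_algebra\<^esub>"
      by (rule bexI[of _ "- p"]) (simp_all add: free_algebra_def)
  qed (simp_all add: free_algebra_def algebra_simps)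
  show "monoid (free_algebra :: (complex, 'a free_alg) module)"
    by (rule monoidI) (simp_all add: free_algebra_def mult.assoc)
qed (simp_all add: free_algebra_def algebra_simps)

definition relation_ideal :: "'g free_alg set \<Rightarrow> 'g free_alg set" where
  "relation_ideal rels = Idl\<^bsub>free_algebra\<^esub> rels"

definition residue_class :: "'g free_alg set \<Rightarrow> 'g free_alg \<Rightarrow> 'g free_alg set" where
  "residue_class rels p = relation_ideal rels +>\<^bsub>free_algebra\<^esub> p"

lemma ideal_relation_ideal: "ideal (relation_ideal rels) free_algebra"
  unfolding relation_ideal_def
  by (rule ring.genideal_ideal[OF ring_free_algebra]) (simp add: free_algebra_def)

lemma relation_ideal_base: "r \<in> rels \<Longrightarrow> r \<in> relation_ideal rels"
  using ring.genideal_self[OF ring_free_algebra, of rels]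
  by (auto simp: relation_ideal_def free_algebra_def)

lemma relation_ideal_zero: "0 \<in> relation_ideal rels"
  using additive_subgroup.zero_closed[OF ideal.axioms(1)[OF ideal_relation_ideal[of rels]]]
  by (simp add: free_algebra_def)

lemma relation_ideal_add:
  "\<lbrakk>p \<in> relation_ideal rels; q \<in> relation_ideal rels\<rbrakk> \<Longrightarrow> p + q \<in> relation_ideal rels"
  using additive_subgroup.a_closed[OF ideal.axioms(1)[OF ideal_relation_ideal[of rels]], of p q]
  by (simp add: free_algebra_def)

lemma relation_ideal_mult_left: "p \<in> relation_ideal rels \<Longrightarrow> u * p \<in> relation_ideal rels"
  using ideal.I_l_closed[OF ideal_relation_ideal[of rels], of p u]
  by (simp add: free_algebra_def)

lemma relation_ideal_mult_right: "p \<in> relation_ideal rels \<Longrightarrow> p * u \<in> relation_ideal rels"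
  using ideal.I_r_closed[OF ideal_relation_ideal[of rels], of p u]
  by (simp add: free_algebra_def)

lemma relation_ideal_uminus: "p \<in> relation_ideal rels \<Longrightarrow> - p \<in> relation_ideal rels"
  using relation_ideal_mult_left[of p rels "- 1"] by simp

lemma residue_class_eq: "residue_class rels p = {r + p | r. r \<in> relation_ideal rels}"
  by (auto simp: residue_class_def a_r_coset_def' free_algebra_def)

lemma residue_class_self: "p \<in> residue_class rels p"
  using relation_ideal_zero[of rels] by (force simp: residue_class_eq)

lemma residue_class_eq_iff:
  "residue_class rels p = residue_class rels q \<longleftrightarrow> p - q \<in> relation_ideal rels"
proof
  assume "residue_class rels p = residue_class rels q"
  then show "p - q \<in> relation_ideal rels"
    using residue_class_self[of p rels] by (auto simp: residue_class_eq)
next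
  have sub: "residue_class rels p \<subseteq> residue_class rels q" if "p - q \<in> relation_ideal rels" for p q
    using relation_ideal_add[OF _ that] by (force simp: residue_class_eq algebra_simps)
  assume "p - q \<in> relation_ideal rels"
  then show "residue_class rels p = residue_class rels q"
    using sub[of p q] sub[of q p] relation_ideal_uminus[of "p - q" rels] by auto
qed

lemmas presented_algebra_unfold =
  presented_algebra_def quotient_algebra_def FactRing_def ring.defs module.defs
  relation_ideal_def[symmetric]

lemma presented_carrier:
  fixes rels :: "'g free_alg set"
  shows "carrier (presented_algebra rels) = range (residue_class rels)"
proof -
  have "carrier free_algebra = (UNIV :: 'g free_alg set)"
    by (simp add: free_algebra_def)
  then show ?thesis
    by (auto simp: presented_algebra_unfold A_RCOSETS_def' residue_class_def a_r_coset_def')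
qed

lemma presented_mult:
  "residue_class rels p \<otimes>\<^bsub>presented_algebra rels\<^esub> residue_class rels q = residue_class rels (p * q)"
  using ideal.rcoset_mult_add[OF ideal_relation_ideal[of rels], of p q]
  by (simp add: presented_algebra_unfold residue_class_def) (simp add: free_algebra_def)

lemma presented_add:
  "residue_class rels p \<oplus>\<^bsub>presented_algebra rels\<^esub> residue_class rels q = residue_class rels (p + q)"
  using ideal.a_rcos_sum[OF ideal_relation_ideal[of rels], of p q]
  by (simp add: presented_algebra_unfold residue_class_def) (simp add: free_algebra_def)

lemma presented_one: "\<one>\<^bsub>presented_algebra rels\<^esub> = residue_class rels 1"
  by (simp add: presented_algebra_unfold residue_class_def) (simp add: free_algebra_def)

lemma presented_zero: "\<zero>\<^bsub>presented_algebra rels\<^esub> = residue_class rels 0"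
  by (simp add: presented_algebra_unfold residue_class_eq)

lemma presented_smult:
  "c \<odot>\<^bsub>presented_algebra rels\<^esub> residue_class rels p = residue_class rels (scal c * p)"
proof -
  have "residue_class rels (scal c * q) = residue_class rels (scal c * p)"
    if "q \<in> residue_class rels p" for q
    using that relation_ideal_mult_left
    by (auto simp: residue_class_eq_iff residue_class_eq[of _ p] right_diff_distrib[symmetric])
  then have "(\<Union>q\<in>residue_class rels p. residue_class rels (scal c * q)) = residue_class rels (scal c * p)"
    using residue_class_self by blast
  then show ?thesis
    by (simp add: presented_algebra_unfold residue_class_def) (simp add: free_algebra_def)
qed

lemmas presented_simps =
  presented_carrier presented_mult presented_add presented_one presented_zero presented_smult

lemma ring_presented: "ring (presented_algebra rels)"
proof (rule ringI)
  show "abelian_group (presented_algebra rels)"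
  proof (rule abelian_groupI)
    fix C assume "C \<in> carrier (presented_algebra rels)"
    then obtain p where "C = residue_class rels p" by (auto simp: presented_simps)
    then show "\<exists>D\<in>carrier (presented_algebra rels).
        D \<oplus>\<^bsub>presented_algebra rels\<^esub> C = \<zero>\<^bsub>presented_algebra rels\<^esub>"
      by (intro bexI[of _ "residue_class rels (- p)"]) (simp_all add: presented_simps)
  qed (auto simp: presented_simps algebra_simps)
  show "monoid (presented_algebra rels)"
    by (rule monoidI) (auto simp: presented_simps mult.assoc)
qed (auto simp: presented_simps algebra_simps)

text \<open>
  A presented algebra is handled through a ring homomorphism on the free algebra whose kernel is
  exactly the ideal of relations: cosets are equal iff their images are.
\<close>

locale faithful_model =
  fixes rels :: "'g free_alg set" and f :: "'g free_alg \<Rightarrow> 'r::ring_1"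
  assumes add: "f (p + q) = f p + f q"
    and mult: "f (p * q) = f p * f q"
    and one: "f 1 = 1"
    and kernel: "f p = 0 \<longleftrightarrow> p \<in> relation_ideal rels"
begin

lemma diff: "f (p - q) = f p - f q"
  using add[of "p - q" q] by (simp add: algebra_simps)

lemma zero: "f 0 = 0"
  using diff[of 0 0] by simp

lemma class_eq_iff: "residue_class rels p = residue_class rels q \<longleftrightarrow> f p = f q"
  by (simp add: residue_class_eq_iff kernel[symmetric] diff)

lemma mem_residue_class_iff: "q \<in> residue_class rels p \<longleftrightarrow> f q = f p"
proof -
  have "q \<in> residue_class rels p \<longleftrightarrow> q - p \<in> relation_ideal rels"
    by (force simp: residue_class_eq)
  then show ?thesis by (simp add: kernel[symmetric] diff)
qed

end

text \<open>
  When two algebras are modelled inside one ring, inclusion of the images gives the embedding: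
  a class goes to the class of all elements that have the same image.
\<close>

lemma clearing_embedding_of_models:
  fixes f :: "'g free_alg \<Rightarrow> 'r::ring_1" and g :: "'h free_alg \<Rightarrow> 'r"
  assumes f: "faithful_model relsR f" and g: "faithful_model relsS g"
    and scal: "\<And>c. f (scal c) = g (scal c)"
    and sub: "range f \<subseteq> range g"
    and domain: "\<And>a b. \<lbrakk>a \<in> range g; b \<in> range g; a * b = 0\<rbrakk> \<Longrightarrow> a = 0 \<or> b = 0"
    and ore: "\<And>a b. \<lbrakk>a \<in> range f; b \<in> range f; a \<noteq> 0; b \<noteq> 0\<rbrakk> \<Longrightarrow>
        \<exists>u\<in>range f. \<exists>v\<in>range f. a * u = b * v \<and> a * u \<noteq> 0"
    and clear: "\<And>a. a \<in> range g \<Longrightarrow> \<exists>r\<in>range f. r \<noteq> 0 \<and> a * r \<in> range f"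
  shows "clearing_embedding (presented_algebra relsR) (presented_algebra relsS)
     (\<lambda>C. {q. \<exists>p\<in>C. g q = f p})"
proof -
  interpret f: faithful_model relsR f by fact
  interpret g: faithful_model relsS g by fact
  let ?R = "presented_algebra relsR" and ?S = "presented_algebra relsS"
  define \<phi> :: "'g free_alg set \<Rightarrow> 'h free_alg set" where "\<phi> = (\<lambda>C. {q. \<exists>p\<in>C. g q = f p})"
  have \<phi>: "\<phi> (residue_class relsR p) = residue_class relsS q" if "g q = f p" for p q
    using that by (auto simp: \<phi>_def f.mem_residue_class_iff g.mem_residue_class_iff
        intro!: residue_class_self)
  have lift: "\<exists>q. g q = f p" for p
    using sub by (metis rangeE rangeI subsetD)
  have assoc: "(c \<odot>\<^bsub>presented_algebra rels\<^esub> C) \<otimes>\<^bsub>presented_algebra rels\<^esub> D =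
      c \<odot>\<^bsub>presented_algebra rels\<^esub> (C \<otimes>\<^bsub>presented_algebra rels\<^esub> D)"
    if "C \<in> carrier (presented_algebra rels)" "D \<in> carrier (presented_algebra rels)"
    for c C D and rels :: "'x free_alg set"
    using that by (auto simp: presented_simps mult.assoc)
  have "right_ore_domain ?R"
  proof (rule right_ore_domain.intro[OF ring_presented], unfold_locales)
    have "g 1 \<noteq> g 0"
      using g.one g.zero by simp
    then have "f 1 \<noteq> f 0"
      using f.one f.zero g.one g.zero by simp
    then show "\<one>\<^bsub>?R\<^esub> \<noteq> \<zero>\<^bsub>?R\<^esub>"
      by (simp add: presented_simps f.class_eq_iff)
  next
    fix C D assume CD: "C \<in> carrier ?R" "D \<in> carrier ?R" "C \<otimes>\<^bsub>?R\<^esub> D = \<zero>\<^bsub>?R\<^esub>"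
    then obtain p q where pq: "C = residue_class relsR p" "D = residue_class relsR q"
      by (auto simp: presented_simps)
    then have "f p * f q = 0"
      using CD(3) by (simp add: presented_simps f.class_eq_iff f.mult f.zero)
    then have "f p = 0 \<or> f q = 0"
      using domain sub by (metis rangeI subsetD)
    then show "C = \<zero>\<^bsub>?R\<^esub> \<or> D = \<zero>\<^bsub>?R\<^esub>"
      by (simp add: pq presented_simps f.class_eq_iff f.zero)
  next
    fix C D assume CD: "C \<in> carrier ?R" "D \<in> carrier ?R" "C \<noteq> \<zero>\<^bsub>?R\<^esub>" "D \<noteq> \<zero>\<^bsub>?R\<^esub>"
    then obtain p q where pq: "C = residue_class relsR p" "D = residue_class relsR q"
      by (auto simp: presented_simps)
    then have "f p \<noteq> 0" "f q \<noteq> 0"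
      using CD by (simp_all add: presented_simps f.class_eq_iff f.zero)
    then obtain u v where "f p * f u = f q * f v" "f p * f u \<noteq> 0"
      using ore[of "f p" "f q"] by auto
    then show "\<exists>U\<in>carrier ?R. \<exists>V\<in>carrier ?R. C \<otimes>\<^bsub>?R\<^esub> U = D \<otimes>\<^bsub>?R\<^esub> V \<and> C \<otimes>\<^bsub>?R\<^esub> U \<noteq> \<zero>\<^bsub>?R\<^esub>"
      by (intro bexI[of _ "residue_class relsR u"] bexI[of _ "residue_class relsR v"])
        (simp_all add: pq presented_simps f.class_eq_iff f.mult f.zero)
  qed
  moreover have "\<phi> \<in> ring_hom ?R ?S"
  proof (rule ring_hom_memI)
    fix C assume "C \<in> carrier ?R"
    then obtain p where "C = residue_class relsR p" by (auto simp: presented_simps)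
    then show "\<phi> C \<in> carrier ?S"
      using \<phi> lift[of p] by (auto simp: presented_simps)
  next
    fix C D assume "C \<in> carrier ?R" "D \<in> carrier ?R"
    then obtain p q where pq: "C = residue_class relsR p" "D = residue_class relsR q"
      by (auto simp: presented_simps)
    obtain p' q' where "g p' = f p" "g q' = f q" using lift by metis
    then show "\<phi> (C \<otimes>\<^bsub>?R\<^esub> D) = \<phi> C \<otimes>\<^bsub>?S\<^esub> \<phi> D" "\<phi> (C \<oplus>\<^bsub>?R\<^esub> D) = \<phi> C \<oplus>\<^bsub>?S\<^esub> \<phi> D"
      using \<phi>[of p' p] \<phi>[of q' q] \<phi>[of "p' * q'" "p * q"] \<phi>[of "p' + q'" "p + q"]
      by (simp_all add: pq presented_simps f.mult g.mult f.add g.add)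
  next
    show "\<phi> \<one>\<^bsub>?R\<^esub> = \<one>\<^bsub>?S\<^esub>"
      using \<phi>[of 1 1] by (simp add: presented_simps f.one g.one)
  qed
  moreover have "inj_on \<phi> (carrier ?R)"
  proof (rule inj_onI)
    fix C D assume "C \<in> carrier ?R" "D \<in> carrier ?R" and eq: "\<phi> C = \<phi> D"
    then obtain p q where pq: "C = residue_class relsR p" "D = residue_class relsR q"
      by (auto simp: presented_simps)
    obtain p' q' where "g p' = f p" "g q' = f q" using lift by metis
    then show "C = D"
      using \<phi>[of p' p] \<phi>[of q' q] eq
      by (simp add: pq f.class_eq_iff g.class_eq_iff)
  qed
  moreover have "C = \<zero>\<^bsub>?S\<^esub> \<or> D = \<zero>\<^bsub>?S\<^esub>"
    if CD: "C \<in> carrier ?S" "D \<in> carrier ?S" "C \<otimes>\<^bsub>?S\<^esub> D = \<zero>\<^bsub>?S\<^esub>" for C D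
  proof -
    obtain p q where pq: "C = residue_class relsS p" "D = residue_class relsS q"
      using CD by (auto simp: presented_simps)
    then have "g p * g q = 0"
      using CD(3) by (simp add: presented_simps g.class_eq_iff g.mult g.zero)
    then have "g p = 0 \<or> g q = 0"
      using domain by blast
    then show ?thesis
      by (simp add: pq presented_simps g.class_eq_iff g.zero)
  qed
  moreover have "\<exists>D\<in>carrier ?R. D \<noteq> \<zero>\<^bsub>?R\<^esub> \<and> C \<otimes>\<^bsub>?S\<^esub> \<phi> D \<in> \<phi> ` carrier ?R"
    if C: "C \<in> carrier ?S" for C
  proof -
    obtain p where p: "C = residue_class relsS p"
      using C by (auto simp: presented_simps)
    obtain r s where rs: "f r \<noteq> 0" "g p * f r = f s"
      using clear[of "g p"] by auto
    obtain r' where r': "g r' = f r" using lift by metis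
    have "C \<otimes>\<^bsub>?S\<^esub> \<phi> (residue_class relsR r) = \<phi> (residue_class relsR s)"
      using \<phi>[OF r'] \<phi>[of "p * r'" s] rs r' by (simp add: p presented_simps g.mult)
    then show ?thesis
      using rs by (intro bexI[of _ "residue_class relsR r"])
        (simp_all add: presented_simps f.class_eq_iff f.zero)
  qed
  moreover have "\<phi> (c \<odot>\<^bsub>?R\<^esub> C) = c \<odot>\<^bsub>?S\<^esub> \<phi> C" if C: "C \<in> carrier ?R" for c C
  proof -
    obtain p where p: "C = residue_class relsR p"
      using C by (auto simp: presented_simps)
    obtain p' where "g p' = f p" using lift by metis
    then show ?thesis
      using \<phi>[of p' p] \<phi>[of "scal c * p'" "scal c * p"]
      by (simp add: p presented_simps f.mult g.mult scal)
  qed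
  ultimately have "clearing_embedding ?R ?S \<phi>"
    by (intro clearing_embedding.intro clearing_embedding_axioms.intro ring_presented assoc)
      (auto simp: presented_simps)
  then show ?thesis by (simp add: \<phi>_def)
qed

section \<open>Normal forms\<close>

definition spanned_mod :: "'g free_alg set \<Rightarrow> ('k \<Rightarrow> 'g free_alg) \<Rightarrow> 'g free_alg set" where
  "spanned_mod rels M =
    {p. \<exists>F c. finite F \<and> p - (\<Sum>k\<in>F. scal (c k) * M k) \<in> relation_ideal rels}"

lemma scal_add: "scal (a + b) = scal a + scal b"
  by (simp add: scal_def single_add)

lemma scal_mult: "scal (a * b) = scal a * scal b"
  by (simp add: scal_def mult_single)

lemma scal_zero: "scal 0 = 0"
  by (simp add: scal_def)

lemma scal_one: "scal 1 = 1"
  by (simp add: scal_def)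

lemma scal_uminus: "scal (- a) = - scal a"
  by (simp add: scal_def single_uminus)

lemma free_alg_induct [case_names zero add scal one gen]:
  fixes p :: "'g free_alg"
  assumes "P 0" and add: "\<And>p q. P p \<Longrightarrow> P q \<Longrightarrow> P (p + q)"
    and scal: "\<And>c p. P p \<Longrightarrow> P (scal c * p)" and "P 1" and gen: "\<And>g p. P p \<Longrightarrow> P (gen g * p)"
  shows "P p"
proof -
  have word: "P (Poly_Mapping.single (FWord w) 1)" for w :: "'g list"
  proof (induction w)
    case Nil
    have "(Poly_Mapping.single (FWord []) 1 :: 'g free_alg) = 1"
      by (simp add: single_one zero_fword_def[symmetric])
    then show ?case using \<open>P 1\<close> by simp
  next
    case (Cons g w)
    have "Poly_Mapping.single (FWord (g # w)) 1 = gen g * Poly_Mapping.single (FWord w) 1"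
      by (simp add: gen_def mult_single plus_fword_def)
    with gen[OF Cons] show ?case by simp
  qed
  have single: "P (Poly_Mapping.single w c)" for w :: "'g fword" and c
  proof -
    have "scal c * Poly_Mapping.single w 1 = Poly_Mapping.single w c"
      by (simp add: scal_def mult_single)
    then show ?thesis using scal[OF word, of c "letters w"] by simp
  qed
  show ?thesis
  proof (induction p rule: update_induct)
    case const
    show ?case by (rule \<open>P 0\<close>)
  next
    case (update f a b)
    then have "Poly_Mapping.update a b f = Poly_Mapping.single a b + f"
      by (intro poly_mapping_eqI)
        (auto simp: lookup_update lookup_add lookup_single when_def in_keys_iff)
    then show ?case using add[OF single update.IH] by simp
  qed
qed

lemma scal_commute: "scal c * p = p * scal c"
proof (induction p rule: free_alg_induct)
  case (add p q)
  then show ?case by (simp only: distrib_left distrib_right)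
next
  case (scal d p)
  have "scal c * (scal d * p) = scal (c * d) * p" by (simp only: scal_mult mult.assoc)
  also have "\<dots> = scal (d * c) * p" by (simp only: mult.commute[of c d])
  also have "\<dots> = scal d * (scal c * p)" by (simp only: scal_mult mult.assoc)
  finally show ?case by (simp only: scal mult.assoc)
next
  case (gen g p)
  have "scal c * gen g = gen g * scal c" by (simp add: scal_def gen_def mult_single)
  then have "scal c * (gen g * p) = gen g * (scal c * p)" by (simp only: mult.assoc[symmetric])
  then show ?case by (simp only: gen mult.assoc)
qed simp_all

lemma spanned_mod_cong:
  assumes "p \<in> spanned_mod rels M" "q - p \<in> relation_ideal rels"
  shows "q \<in> spanned_mod rels M"
proof -
  obtain F c where F: "finite F" "p - (\<Sum>k\<in>F. scal (c k) * M k) \<in> relation_ideal rels"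
    using assms(1) by (auto simp: spanned_mod_def)
  have "q - (\<Sum>k\<in>F. scal (c k) * M k) = (q - p) + (p - (\<Sum>k\<in>F. scal (c k) * M k))" by simp
  then show ?thesis
    using relation_ideal_add[OF assms(2) F(2)] F(1) by (auto simp: spanned_mod_def)
qed

lemma spanned_mod_ideal: "p \<in> relation_ideal rels \<Longrightarrow> p \<in> spanned_mod rels M"
  unfolding spanned_mod_def by (auto intro!: exI[of _ "{}"])

lemma spanned_mod_add:
  assumes "p \<in> spanned_mod rels M" "q \<in> spanned_mod rels M"
  shows "p + q \<in> spanned_mod rels M"
proof -
  obtain F c where F: "finite F" "p - (\<Sum>k\<in>F. scal (c k) * M k) \<in> relation_ideal rels"
    using assms(1) by (auto simp: spanned_mod_def)
  obtain G d where G: "finite G" "q - (\<Sum>k\<in>G. scal (d k) * M k) \<in> relation_ideal rels"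
    using assms(2) by (auto simp: spanned_mod_def)
  let ?c = "\<lambda>k. if k \<in> F then c k else 0" and ?d = "\<lambda>k. if k \<in> G then d k else 0"
  have "(\<Sum>k\<in>F. scal (c k) * M k) = (\<Sum>k\<in>F \<union> G. scal (?c k) * M k)"
    by (rule sum.mono_neutral_cong_left) (use F G in \<open>auto simp: scal_zero\<close>)
  moreover have "(\<Sum>k\<in>G. scal (d k) * M k) = (\<Sum>k\<in>F \<union> G. scal (?d k) * M k)"
    by (rule sum.mono_neutral_cong_left) (use F G in \<open>auto simp: scal_zero\<close>)
  ultimately have "p + q - (\<Sum>k\<in>F \<union> G. scal (?c k + ?d k) * M k) =
      (p - (\<Sum>k\<in>F. scal (c k) * M k)) + (q - (\<Sum>k\<in>G. scal (d k) * M k))"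
    by (simp add: scal_add distrib_right sum.distrib)
  then have "p + q - (\<Sum>k\<in>F \<union> G. scal (?c k + ?d k) * M k) \<in> relation_ideal rels"
    using relation_ideal_add[OF F(2) G(2)] by (simp only:)
  then show ?thesis
    unfolding spanned_mod_def mem_Collect_eq using F(1) G(1) by (intro exI conjI) auto
qed

lemma spanned_mod_scal:
  assumes "p \<in> spanned_mod rels M"
  shows "scal a * p \<in> spanned_mod rels M"
proof -
  obtain F c where F: "finite F" "p - (\<Sum>k\<in>F. scal (c k) * M k) \<in> relation_ideal rels"
    using assms(1) by (auto simp: spanned_mod_def)
  have "scal a * p - (\<Sum>k\<in>F. scal (a * c k) * M k) = scal a * (p - (\<Sum>k\<in>F. scal (c k) * M k))"
    by (simp add: scal_mult sum_distrib_left right_diff_distrib mult.assoc)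
  then show ?thesis
    using relation_ideal_mult_left[OF F(2), of "scal a"] F(1) unfolding spanned_mod_def
    by (auto intro!: exI[of _ F] exI[of _ "\<lambda>k. a * c k"])
qed

lemma spanned_mod_base: "M k \<in> spanned_mod rels M"
  using relation_ideal_zero[of rels] unfolding spanned_mod_def
  by (auto intro!: exI[of _ "{k}"] exI[of _ "\<lambda>_. 1"] simp: scal_one)

lemma spanned_mod_sum:
  assumes "\<And>k. k \<in> F \<Longrightarrow> p k \<in> spanned_mod rels M"
  shows "sum p F \<in> spanned_mod rels M"
  using assms
  by (induction F rule: infinite_finite_induct)
    (auto intro: spanned_mod_add spanned_mod_ideal relation_ideal_zero)

lemma spanned_mod_left_mult:
  assumes M: "\<And>k. u * M k \<in> spanned_mod rels M" and p: "p \<in> spanned_mod rels M"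
  shows "u * p \<in> spanned_mod rels M"
proof -
  obtain F c where F: "finite F" "p - (\<Sum>k\<in>F. scal (c k) * M k) \<in> relation_ideal rels"
    using p by (auto simp: spanned_mod_def)
  have "u * (scal (c k) * M k) = scal (c k) * (u * M k)" for k
    using scal_commute[of "c k" u] by (metis mult.assoc)
  then have "u * (\<Sum>k\<in>F. scal (c k) * M k) \<in> spanned_mod rels M"
    by (simp add: sum_distrib_left spanned_mod_sum spanned_mod_scal M)
  then show ?thesis
    by (rule spanned_mod_cong)
      (use relation_ideal_mult_left[OF F(2), of u] in \<open>simp add: right_diff_distrib\<close>)
qed

text \<open>
  If the relations suffice to rewrite every word into the family \<open>M\<close>, and \<open>M\<close> stays linearly
  independent in the model, then the model satisfies no further relation.
\<close>

lemma faithful_modelI: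
  fixes f :: "'g free_alg \<Rightarrow> 'r::ring_1" and M :: "'k \<Rightarrow> 'g free_alg"
  assumes add: "\<And>p q. f (p + q) = f p + f q"
    and mult: "\<And>p q. f (p * q) = f p * f q"
    and one: "f 1 = 1"
    and rels: "\<And>r. r \<in> rels \<Longrightarrow> f r = 0"
    and spanning: "1 \<in> spanned_mod rels M" "\<And>g k. gen g * M k \<in> spanned_mod rels M"
    and independent: "\<And>F c k. \<lbrakk>finite F; f (\<Sum>k\<in>F. scal (c k) * M k) = 0; k \<in> F\<rbrakk> \<Longrightarrow> c k = 0"
  shows "faithful_model rels f"
proof
  fix p
  have diff: "f (p - q) = f p - f q" for p q
    using add[of "p - q" q] by (simp add: algebra_simps)
  then have zero: "f 0 = 0"
    using diff[of 0 0] by simp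
  have "ideal {p. f p = 0} free_algebra"
  proof (rule idealI[OF ring_free_algebra])
    have minus: "inv\<^bsub>add_monoid free_algebra\<^esub> q = - q" for q :: "'g free_alg"
      using abelian_group.minus_equality[OF ring.is_abelian_group[OF ring_free_algebra], of "- q" q]
      by (simp add: free_algebra_def a_inv_def)
    show "subgroup {p. f p = 0} (add_monoid free_algebra)"
    proof
      fix q assume "q \<in> {p. f p = 0}"
      then show "inv\<^bsub>add_monoid free_algebra\<^esub> q \<in> {p. f p = 0}"
        using diff[of 0 q] zero minus[of q] by simp
    qed (auto simp: free_algebra_def add zero)
  qed (auto simp: free_algebra_def mult)
  then have "relation_ideal rels \<subseteq> {p. f p = 0}"
    unfolding relation_ideal_def using rels
    by (intro ring.genideal_minimal[OF ring_free_algebra]) auto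
  moreover have "p \<in> spanned_mod rels M" for p
    by (induction p rule: free_alg_induct)
      (auto intro: spanned_mod_ideal relation_ideal_zero spanned_mod_add spanned_mod_scal spanning
        spanned_mod_left_mult)
  then obtain F c where F: "finite F" "p - (\<Sum>k\<in>F. scal (c k) * M k) \<in> relation_ideal rels"
    unfolding spanned_mod_def by blast
  ultimately have *: "f p = f (\<Sum>k\<in>F. scal (c k) * M k)"
    using diff by auto
  show "f p = 0 \<longleftrightarrow> p \<in> relation_ideal rels"
  proof
    assume "f p = 0"
    then have "\<forall>k\<in>F. c k = 0" using independent[OF F(1)] * by simp
    then have "(\<Sum>k\<in>F. scal (c k) * M k) = 0" by (simp add: scal_zero)
    then show "p \<in> relation_ideal rels" using F(2) by simp
  next
    assume "p \<in> relation_ideal rels"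
    then show "f p = 0" using \<open>relation_ideal rels \<subseteq> {p. f p = 0}\<close> by auto
  qed
qed (use add mult one in auto)

section \<open>Operators on sequences of polynomials\<close>

text \<open>
  Sequences of polynomials in one variable \<open>h\<close> carry all the algebras in question. Taking operators
  rather than formal skew Laurent series as the ambient ring makes associativity a property of
  composition, and the ring is the same for every \<open>lam\<close>.
\<close>

typedef operator =
  "{t :: (int \<Rightarrow> complex poly) \<Rightarrow> (int \<Rightarrow> complex poly).
     (\<forall>f g. t (\<lambda>n. f n + g n) = (\<lambda>n. t f n + t g n)) \<and>
     (\<forall>c f. t (\<lambda>n. [:c:] * f n) = (\<lambda>n. [:c:] * t f n))}"
  morphisms apply_op Abs_operator
  by (rule exI[of _ "\<lambda>f. f"]) simp

setup_lifting type_definition_operator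

instantiation operator :: ring_1
begin

lift_definition zero_operator :: operator is "\<lambda>f n. 0" by simp
lift_definition one_operator :: operator is "\<lambda>f. f" by simp
lift_definition plus_operator :: "operator \<Rightarrow> operator \<Rightarrow> operator"
  is "\<lambda>s t f n. s f n + t f n" by (simp add: distrib_left add_ac)
lift_definition minus_operator :: "operator \<Rightarrow> operator \<Rightarrow> operator"
  is "\<lambda>s t f n. s f n - t f n" by (simp add: smult_diff_right fun_eq_iff)
lift_definition uminus_operator :: "operator \<Rightarrow> operator" is "\<lambda>t f n. - t f n" by simp
lift_definition times_operator :: "operator \<Rightarrow> operator \<Rightarrow> operator"
  is "\<lambda>s t f. s (t f)" by simp

instance
proof
  show "(0 :: operator) \<noteq> 1"
  proof
    assume "(0 :: operator) = 1"
    then have "apply_op 0 (\<lambda>n. 1) 0 = apply_op 1 (\<lambda>n. 1) 0" by simp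
    then show False by transfer simp
  qed
qed (transfer; simp add: add_ac fun_eq_iff)+

end

lift_definition const_op :: "complex \<Rightarrow> operator" is "\<lambda>c f n. [:c:] * f n"
  by (simp add: mult_ac smult_add_right)

text \<open>
  The variable acts at position \<open>n\<close> as \<open>lam\<^sup>n h\<close>; moving one position therefore rescales \<open>h\<close> by
  \<open>lam\<close>, which is the commutation rule \<open>X H = lam H X\<close>.
\<close>

lift_definition poly_op :: "complex \<Rightarrow> complex poly \<Rightarrow> operator"
  is "\<lambda>lam p f n. pcompose p [:0, lam powi n:] * f n"
  by (simp add: algebra_simps)

lift_definition shift_op :: "int \<Rightarrow> operator" is "\<lambda>j f n. f (n + j)" by simp

text \<open>
  Applied to a finite sum of terms \<open>p\<^sub>j(H) X\<^sup>j\<close>, this recovers the coefficient \<open>p\<^sub>j\<close>, because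
  \<open>X\<^sup>j\<close> moves only the unit sequence at position \<open>j\<close> to position \<open>0\<close> and \<open>lam\<^sup>0 = 1\<close>.
\<close>

definition symbol :: "operator \<Rightarrow> int \<Rightarrow> complex poly" where
  "symbol t j = apply_op t (\<lambda>n. if n = j then 1 else 0) 0"

lemma symbol_add: "symbol (s + t) j = symbol s j + symbol t j"
  by (simp add: symbol_def plus_operator.rep_eq)

lemma symbol_zero: "symbol 0 j = 0"
  by (simp add: symbol_def zero_operator.rep_eq)

lemma symbol_sum: "symbol (sum t F) j = (\<Sum>k\<in>F. symbol (t k) j)"
  by (induction F rule: infinite_finite_induct) (simp_all add: symbol_add symbol_zero)

lemma symbol_const: "symbol (const_op c * t) j = [:c:] * symbol t j"
  by (simp add: symbol_def const_op.rep_eq times_operator.rep_eq)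

lemma symbol_poly_shift: "symbol (poly_op lam p * shift_op k) j = (if j = k then p else 0)"
  by (simp add: symbol_def poly_op.rep_eq shift_op.rep_eq times_operator.rep_eq)

lemma const_op_add: "const_op (a + b) = const_op a + const_op b"
  by transfer (auto simp: fun_eq_iff smult_add_left)

lemma const_op_mult: "const_op (a * b) = const_op a * const_op b"
  by transfer (auto simp: fun_eq_iff mult.commute)

lemma const_op_zero: "const_op 0 = 0"
  by transfer (auto simp: fun_eq_iff)

lemma const_op_one: "const_op 1 = 1"
  by transfer (auto simp: fun_eq_iff)

lemma const_op_commute: "const_op c * t = t * const_op c"
  by transfer (auto simp: fun_eq_iff)

lemma poly_op_add: "poly_op lam (p + q) = poly_op lam p + poly_op lam q"
  by transfer (simp add: fun_eq_iff pcompose_add distrib_right)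

lemma poly_op_mult: "poly_op lam (p * q) = poly_op lam p * poly_op lam q"
  by transfer (simp add: fun_eq_iff pcompose_mult mult.assoc)

lemma poly_op_const: "poly_op lam [:c:] = const_op c"
  by transfer (simp add: fun_eq_iff)

lemma poly_op_zero: "poly_op lam 0 = 0"
  by transfer (simp add: fun_eq_iff)

lemma poly_op_one: "poly_op lam 1 = 1"
  by transfer (simp add: fun_eq_iff pcompose_1)

lemma poly_op_uminus: "poly_op lam (- p) = - poly_op lam p"
  by transfer (simp add: fun_eq_iff pcompose_uminus)

lemma poly_op_power: "poly_op lam (p ^ n) = poly_op lam p ^ n"
  by (induction n) (simp_all add: poly_op_one poly_op_mult)

lemma poly_op_eq_zero_iff: "poly_op lam p = 0 \<longleftrightarrow> p = 0"
proof
  assume "poly_op lam p = 0"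
  then show "p = 0"
    using symbol_poly_shift[of lam p 0 0] symbol_zero[of 0] by simp
qed (simp add: poly_op_zero)

lemma shift_op_add: "shift_op (i + j) = shift_op i * shift_op j"
  by transfer (simp add: fun_eq_iff add_ac)

lemma shift_op_zero: "shift_op 0 = 1"
  by transfer simp

lemma shift_op_power: "shift_op i ^ n = shift_op (int n * i)"
  by (induction n) (simp_all add: shift_op_zero shift_op_add[symmetric] algebra_simps)

text \<open>
  The automorphism \<open>h \<mapsto> lam\<^sup>j h\<close>, by which \<open>X\<^sup>j\<close> twists coefficients.
\<close>

definition dilate :: "complex \<Rightarrow> int \<Rightarrow> complex poly \<Rightarrow> complex poly" where
  "dilate lam j p = pcompose p [:0, lam powi j:]"

lemma shift_poly_op:
  assumes "lam \<noteq> 0"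
  shows "shift_op j * poly_op lam p = poly_op lam (dilate lam j p) * shift_op j"
proof -
  have "pcompose (dilate lam j p) [:0, lam powi n:] = pcompose p [:0, lam powi (n + j):]" for n
    using assms by (simp add: dilate_def pcompose_assoc[symmetric] pcompose_pCons power_int_add mult.commute)
  then have "apply_op (shift_op j * poly_op lam p) f n =
      apply_op (poly_op lam (dilate lam j p) * shift_op j) f n" for f n
    by (simp only: times_operator.rep_eq poly_op.rep_eq shift_op.rep_eq)
  then show ?thesis
    by (intro apply_op_inject[THEN iffD1] ext)
qed

lemma dilate_dilate:
  assumes "lam \<noteq> 0"
  shows "dilate lam i (dilate lam j p) = dilate lam (i + j) p"
  using assms by (simp add: dilate_def pcompose_assoc[symmetric] pcompose_pCons power_int_add mult.commute)

lemma dilate_0: "dilate lam 0 p = p"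
  by (simp add: dilate_def)

lemma dilate_zero: "dilate lam j 0 = 0"
  by (simp add: dilate_def)

lemma dilate_eq_0_iff: "lam \<noteq> 0 \<Longrightarrow> dilate lam j p = 0 \<longleftrightarrow> p = 0"
  using dilate_dilate[of lam "- j" j p] by (auto simp: dilate_0 dilate_zero)

lemma dilate_pCons_0_1: "dilate lam j [:0, 1:] = [:0, lam powi j:]"
  by (simp add: dilate_def pcompose_pCons)

section \<open>Skew polynomials\<close>

text \<open>
  The sums of terms \<open>p\<^sub>j(H) X\<^sup>j\<close> with \<open>j < n\<close>, that is, the elements of degree below \<open>n\<close> in the
  skew polynomial ring \<open>\<complex>[H][X]\<close>.
\<close>

inductive_set skew_below :: "complex \<Rightarrow> nat \<Rightarrow> operator set" for lam n where
  zero: "0 \<in> skew_below lam n"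
| step: "\<lbrakk>t \<in> skew_below lam n; j < n\<rbrakk> \<Longrightarrow> t + poly_op lam p * shift_op (int j) \<in> skew_below lam n"

definition skew_polys :: "complex \<Rightarrow> operator set" where
  "skew_polys lam = (\<Union>n. skew_below lam n)"

lemma skew_below_mono: "\<lbrakk>t \<in> skew_below lam m; m \<le> n\<rbrakk> \<Longrightarrow> t \<in> skew_below lam n"
  by (induction rule: skew_below.induct) (auto intro: skew_below.intros)

lemma skew_below_term: "j < n \<Longrightarrow> poly_op lam p * shift_op (int j) \<in> skew_below lam n"
  using skew_below.step[OF skew_below.zero, of j n lam p] by simp

lemma skew_below_add:
  assumes "s \<in> skew_below lam n" "t \<in> skew_below lam n"
  shows "s + t \<in> skew_below lam n"
  using assms(2)
proof (induction rule: skew_below.induct)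
  case (step t j p)
  then show ?case using skew_below.step[of "s + t" lam n j p] by (simp add: add.assoc)
qed (use assms(1) in simp)

lemma poly_shift_mult:
  assumes "lam \<noteq> 0"
  shows "(poly_op lam p * shift_op i) * (poly_op lam q * shift_op j) =
    poly_op lam (p * dilate lam i q) * shift_op (i + j)"
  using shift_poly_op[OF assms, of i q]
  by (simp add: poly_op_mult shift_op_add mult.assoc) (metis mult.assoc)

lemma skew_below_mult_term:
  assumes "lam \<noteq> 0" "t \<in> skew_below lam n"
  shows "t * (poly_op lam p * shift_op (int k)) \<in> skew_below lam (n + k)"
  using assms(2)
proof (induction rule: skew_below.induct)
  case (step t j q)
  have "(poly_op lam q * shift_op (int j)) * (poly_op lam p * shift_op (int k)) \<in> skew_below lam (n + k)"
    using step(2) skew_below_term[of "j + k"] by (simp add: poly_shift_mult[OF assms(1)])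
  then show ?case using step by (simp add: distrib_right skew_below_add)
qed (simp add: skew_below.zero)

lemma skew_below_mult:
  assumes "lam \<noteq> 0" "s \<in> skew_below lam m" "t \<in> skew_below lam (Suc k)"
  shows "s * t \<in> skew_below lam (m + k)"
  using assms(3)
proof (induction rule: skew_below.induct)
  case (step t j p)
  have "s * (poly_op lam p * shift_op (int j)) \<in> skew_below lam (m + k)"
    using skew_below_mono[OF skew_below_mult_term[OF assms(1,2)]] step(2) by simp
  then show ?case using step by (simp add: distrib_left skew_below_add)
qed (simp add: skew_below.zero)

lemma skew_below_term_mult:
  assumes "lam \<noteq> 0" "t \<in> skew_below lam n"
  shows "(poly_op lam p * shift_op (int k)) * t \<in> skew_below lam (k + n)"
  using assms(2)
proof (induction rule: skew_below.induct)
  case (step t j q)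
  have "(poly_op lam p * shift_op (int k)) * (poly_op lam q * shift_op (int j)) \<in> skew_below lam (k + n)"
    using step(2) skew_below_term[of "k + j"] by (simp add: poly_shift_mult[OF assms(1)])
  then show ?case using step by (simp add: distrib_left skew_below_add)
qed (simp add: skew_below.zero)

lemma skew_below_uminus: "t \<in> skew_below lam n \<Longrightarrow> - t \<in> skew_below lam n"
proof (induction rule: skew_below.induct)
  case (step t j p)
  then show ?case using skew_below.step[of "- t" lam n j "- p"] by (simp add: poly_op_uminus)
qed (simp add: skew_below.zero)

lemma skew_below_diff:
  "\<lbrakk>s \<in> skew_below lam n; t \<in> skew_below lam n\<rbrakk> \<Longrightarrow> s - t \<in> skew_below lam n"
  using skew_below_add[of s lam n "- t"] skew_below_uminus by simp

lemma symbol_skew_below: "\<lbrakk>t \<in> skew_below lam n; int n \<le> k\<rbrakk> \<Longrightarrow> symbol t k = 0"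
  by (induction rule: skew_below.induct) (auto simp: symbol_zero symbol_add symbol_poly_shift)

lemma skew_leading_term_nonzero:
  assumes "t \<in> skew_below lam n" "p \<noteq> 0"
  shows "t + poly_op lam p * shift_op (int n) \<noteq> 0"
proof
  assume "t + poly_op lam p * shift_op (int n) = 0"
  then have "symbol (t + poly_op lam p * shift_op (int n)) (int n) = 0"
    by (simp add: symbol_zero)
  then show False
    using assms by (simp add: symbol_add symbol_poly_shift symbol_skew_below)
qed

lemma skew_below_Suc:
  assumes "t \<in> skew_below lam (Suc n)"
  shows "\<exists>s\<in>skew_below lam n. \<exists>p. t = s + poly_op lam p * shift_op (int n)"
  using assms
proof (induction rule: skew_below.induct)
  case zero
  show ?case
    by (intro bexI[of _ 0] exI[of _ 0]) (simp_all add: skew_below.zero poly_op_zero)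
next
  case (step t j q)
  then obtain s p where s: "s \<in> skew_below lam n" "t = s + poly_op lam p * shift_op (int n)"
    by blast
  show ?case
  proof (cases "j = n")
    case True
    then show ?thesis
      using s by (intro bexI[of _ s] exI[of _ "p + q"]) (simp_all add: poly_op_add algebra_simps)
  next
    case False
    then show ?thesis
      using s step(2)
      by (intro bexI[of _ "s + poly_op lam q * shift_op (int j)"] exI[of _ p])
        (simp_all add: skew_below.step algebra_simps)
  qed
qed

lemma skew_leading_term:
  assumes "t \<in> skew_below lam n" "t \<noteq> 0"
  obtains m s p where "m < n" "s \<in> skew_below lam m" "p \<noteq> 0" "t = s + poly_op lam p * shift_op (int m)"
  using assms
proof (induction n arbitrary: thesis)
  case 0
  have "t = 0" using 0(2) by cases auto
  with 0(3) show ?case by simp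
next
  case (Suc n)
  obtain s p where s: "s \<in> skew_below lam n" "t = s + poly_op lam p * shift_op (int n)"
    using skew_below_Suc[OF Suc.prems(2)] by blast
  show ?case
  proof (cases "p = 0")
    case True
    then have t: "t \<in> skew_below lam n" using s by (simp add: poly_op_zero)
    show ?thesis
      by (rule Suc.IH[OF _ t Suc.prems(3)]) (rule Suc.prems(1), simp_all)
  next
    case False
    then show ?thesis using Suc.prems(1) s by blast
  qed
qed

text \<open>
  If \<open>p X\<^sup>m\<close> and \<open>q X\<^sup>n\<close> are the leading terms, then the product has degree \<open>m + n\<close> and leading
  coefficient \<open>p(h) q(lam\<^sup>m h)\<close>, a product of nonzero polynomials over a field.
\<close>

lemma skew_mult_nonzero:
  assumes lam: "lam \<noteq> 0" and "s \<in> skew_polys lam" "t \<in> skew_polys lam" "s \<noteq> 0" "t \<noteq> 0"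
  shows "s * t \<noteq> 0"
proof -
  obtain m s' p where s: "s' \<in> skew_below lam m" "p \<noteq> 0" "s = s' + poly_op lam p * shift_op (int m)"
    using assms skew_leading_term unfolding skew_polys_def by (metis UN_iff)
  obtain n t' q where t: "t' \<in> skew_below lam n" "q \<noteq> 0" "t = t' + poly_op lam q * shift_op (int n)"
    using assms skew_leading_term unfolding skew_polys_def by (metis UN_iff)
  have "t \<in> skew_below lam (Suc n)"
    unfolding t(3) by (intro skew_below_add skew_below_term skew_below_mono[OF t(1)]) auto
  then have "s' * t \<in> skew_below lam (m + n)"
    using skew_below_mult[OF lam s(1)] by blast
  moreover have "(poly_op lam p * shift_op (int m)) * t' \<in> skew_below lam (m + n)"
    using skew_below_term_mult[OF lam t(1)] .
  ultimately have "s' * t + (poly_op lam p * shift_op (int m)) * t' \<in> skew_below lam (m + n)"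
    by (rule skew_below_add)
  moreover have "s * t = (s' * t + (poly_op lam p * shift_op (int m)) * t') +
      poly_op lam (p * dilate lam (int m) q) * shift_op (int (m + n))"
    using poly_shift_mult[OF lam, of p "int m" q "int n"]
    by (simp add: s(3) distrib_right) (simp add: t(3) distrib_left add.assoc)
  moreover have "p * dilate lam (int m) q \<noteq> 0"
    using s(2) t(2) by (simp add: dilate_eq_0_iff[OF lam])
  ultimately show ?thesis
    using skew_leading_term_nonzero by metis
qed

lemma skew_polys_mult:
  assumes lam: "lam \<noteq> 0" and "s \<in> skew_polys lam" "t \<in> skew_polys lam"
  shows "s * t \<in> skew_polys lam"
proof -
  obtain m n where "s \<in> skew_below lam m" "t \<in> skew_below lam n"
    using assms by (auto simp: skew_polys_def)
  then show ?thesis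
    using skew_below_mult[OF lam, of s m t n] skew_below_mono[of t lam n "Suc n"]
    by (auto simp: skew_polys_def)
qed

lemma skew_polys_add:
  assumes "s \<in> skew_polys lam" "t \<in> skew_polys lam"
  shows "s + t \<in> skew_polys lam"
proof -
  obtain m n where "s \<in> skew_below lam m" "t \<in> skew_below lam n"
    using assms by (auto simp: skew_polys_def)
  then show ?thesis
    using skew_below_add[of s lam "max m n" t] skew_below_mono[of _ lam _ "max m n"]
    by (auto simp: skew_polys_def)
qed

lemma skew_polys_term: "poly_op lam p * shift_op (int j) \<in> skew_polys lam"
  using skew_below_term[of j "Suc j"] by (auto simp: skew_polys_def)

lemma skew_polys_poly: "poly_op lam p \<in> skew_polys lam"
  using skew_polys_term[of lam p 0] by (simp add: shift_op_zero)

lemma skew_polys_shift: "shift_op (int j) \<in> skew_polys lam"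
  using skew_polys_term[of lam 1 j] by (simp add: poly_op_one)

text \<open>
  Euclid's algorithm without division: the coefficients commute, so cross-multiplying them
  cancels the leading term of the factor of higher degree. If \<open>c = a u - b v\<close> is the
  remainder and \<open>c e = b f\<close>, then \<open>a (u e) = b (v e + f)\<close>.
\<close>

lemma skew_ore_below:
  assumes lam: "lam \<noteq> 0"
  shows "\<lbrakk>a \<in> skew_below lam m; b \<in> skew_below lam n; a \<noteq> 0; b \<noteq> 0\<rbrakk> \<Longrightarrow>
    \<exists>u\<in>skew_polys lam. \<exists>v\<in>skew_polys lam. a * u = b * v \<and> a * u \<noteq> 0"
proof (induction "m + n" arbitrary: a b m n rule: less_induct)
  case less
  have cancel_leading: "\<exists>u\<in>skew_polys lam. \<exists>v\<in>skew_polys lam. a * u = b * v \<and> a * u \<noteq> 0"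
    if a: "J < M" "a' \<in> skew_below lam J" "p \<noteq> 0" "a = a' + poly_op lam p * shift_op (int J)"
      and b: "K < N" "b' \<in> skew_below lam K" "q \<noteq> 0" "b = b' + poly_op lam q * shift_op (int K)"
      and JK: "K \<le> J" and MN: "M + N \<le> m + n"
    for a b a' b' J K M N p q
  proof -
    \<comment> \<open>The dilations undo the twist by \<open>X\<^sup>J\<close> and \<open>X\<^sup>K\<close>, so that both products have leading
      coefficient \<open>p q\<close>.\<close>
    define u where "u = poly_op lam (dilate lam (- int J) q)"
    define v where "v = poly_op lam (dilate lam (- int K) p) * shift_op (int (J - K))"
    define c where "c = a * u - b * v"
    have u_term: "u = poly_op lam (dilate lam (- int J) q) * shift_op (int 0)"
      by (simp add: u_def shift_op_zero)
    have in_skew: "u \<in> skew_polys lam" "v \<in> skew_polys lam"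
      unfolding u_def v_def by (rule skew_polys_poly, rule skew_polys_term)
    have "u \<noteq> 0"
      using b(3) by (simp add: u_def poly_op_eq_zero_iff dilate_eq_0_iff[OF lam])
    have a_skew: "a \<in> skew_polys lam" "a \<noteq> 0"
      using skew_leading_term_nonzero[OF a(2,3)] a(4)
      by (auto simp: skew_polys_def intro!: exI[of _ "Suc J"] skew_below_add skew_below_term
          skew_below_mono[OF a(2)])
    have b_below: "b \<in> skew_below lam (Suc K)" "b \<noteq> 0"
      using skew_leading_term_nonzero[OF b(2,3)] b(4)
      by (auto intro!: skew_below_add skew_below_term skew_below_mono[OF b(2)])
    have lead_a: "(poly_op lam p * shift_op (int J)) * u = poly_op lam (p * q) * shift_op (int J)"
      unfolding u_term poly_shift_mult[OF lam] dilate_dilate[OF lam] by (simp add: dilate_0)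
    have lead_b: "(poly_op lam q * shift_op (int K)) * v = poly_op lam (p * q) * shift_op (int J)"
      unfolding v_def poly_shift_mult[OF lam] dilate_dilate[OF lam]
      using JK by (simp add: dilate_0 mult.commute of_nat_diff)
    have "c = a' * u - b' * v"
      unfolding c_def a(4) b(4) distrib_right lead_a lead_b by simp
    moreover have "a' * u \<in> skew_below lam J"
      using skew_below_mult_term[OF lam a(2), of _ 0] unfolding u_term by simp
    moreover have "b' * v \<in> skew_below lam J"
      using skew_below_mult_term[OF lam b(2), of _ "J - K"] JK unfolding v_def by simp
    ultimately have c: "c \<in> skew_below lam J"
      using skew_below_diff by simp
    show ?thesis
    proof (cases "c = 0")
      case True
      then have "a * u = b * v" by (simp add: c_def)
      moreover have "a * u \<noteq> 0"
        using skew_mult_nonzero[OF lam a_skew(1) in_skew(1) a_skew(2)] \<open>u \<noteq> 0\<close> by simp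
      ultimately show ?thesis using in_skew by blast
    next
      case False
      have "J + Suc K < m + n" using a(1) b(1) MN by linarith
      then obtain e f where ef: "e \<in> skew_polys lam" "f \<in> skew_polys lam" "c * e = b * f"
          "c * e \<noteq> 0"
        using less.hyps[of J "Suc K" c b] c b_below False by blast
      have "a * (u * e) = b * (v * e + f)"
        using ef(3) by (simp add: c_def algebra_simps)
      moreover have "a * (u * e) \<noteq> 0"
        using ef(4) a_skew in_skew ef(1) \<open>u \<noteq> 0\<close>
        by (metis lam mult_zero_right skew_mult_nonzero skew_polys_mult)
      moreover have "u * e \<in> skew_polys lam" "v * e + f \<in> skew_polys lam"
        using in_skew ef by (auto intro!: skew_polys_mult[OF lam] skew_polys_add)
      ultimately show ?thesis by blast
    qed
  qed
  obtain J a' p where a: "J < m" "a' \<in> skew_below lam J" "p \<noteq> 0"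
      "a = a' + poly_op lam p * shift_op (int J)"
    using skew_leading_term[OF less.prems(1,3)] by metis
  obtain K b' q where b: "K < n" "b' \<in> skew_below lam K" "q \<noteq> 0"
      "b = b' + poly_op lam q * shift_op (int K)"
    using skew_leading_term[OF less.prems(2,4)] by metis
  show ?case
  proof (cases "K \<le> J")
    case True
    then show ?thesis using cancel_leading[OF a b] by simp
  next
    case False
    then have "\<exists>u\<in>skew_polys lam. \<exists>v\<in>skew_polys lam. b * u = a * v \<and> b * u \<noteq> 0"
      using cancel_leading[OF b a] by simp
    then show ?thesis by metis
  qed
qed

lemma skew_ore:
  assumes "lam \<noteq> 0" "a \<in> skew_polys lam" "b \<in> skew_polys lam" "a \<noteq> 0" "b \<noteq> 0"
  shows "\<exists>u\<in>skew_polys lam. \<exists>v\<in>skew_polys lam. a * u = b * v \<and> a * u \<noteq> 0"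
proof -
  obtain m n where "a \<in> skew_below lam m" "b \<in> skew_below lam n"
    using assms(2,3) by (auto simp: skew_polys_def)
  then show ?thesis using skew_ore_below[OF assms(1)] assms(4,5) by blast
qed

section \<open>Evaluation of noncommutative polynomials in operators\<close>

definition word_op :: "('g \<Rightarrow> operator) \<Rightarrow> 'g fword \<Rightarrow> operator" where
  "word_op T w = prod_list (map T (letters w))"

definition evaluate :: "('g \<Rightarrow> operator) \<Rightarrow> 'g free_alg \<Rightarrow> operator" where
  "evaluate T p = (\<Sum>w\<in>Poly_Mapping.keys p. const_op (Poly_Mapping.lookup p w) * word_op T w)"

lemma evaluate_superset:
  assumes "finite W" "Poly_Mapping.keys p \<subseteq> W"
  shows "evaluate T p = (\<Sum>w\<in>W. const_op (Poly_Mapping.lookup p w) * word_op T w)"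
  unfolding evaluate_def
  by (rule sum.mono_neutral_left) (use assms in \<open>auto simp: in_keys_iff const_op_zero\<close>)

lemma evaluate_add: "evaluate T (p + q) = evaluate T p + evaluate T q"
proof -
  let ?W = "Poly_Mapping.keys p \<union> Poly_Mapping.keys q"
  have "evaluate T (p + q) =
      (\<Sum>w\<in>?W. const_op (Poly_Mapping.lookup (p + q) w) * word_op T w)"
    by (rule evaluate_superset) (simp_all add: keys_add)
  also have "\<dots> = evaluate T p + evaluate T q"
    using evaluate_superset[of ?W p T] evaluate_superset[of ?W q T]
    by (simp add: lookup_add const_op_add distrib_right sum.distrib)
  finally show ?thesis .
qed

lemma evaluate_single: "evaluate T (Poly_Mapping.single w c) = const_op c * word_op T w"
  using evaluate_superset[of "{w}" "Poly_Mapping.single w c" T] by simp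

lemma evaluate_zero: "evaluate T 0 = 0"
  by (simp add: evaluate_def)

lemma evaluate_scal: "evaluate T (scal c) = const_op c"
  unfolding scal_def evaluate_single by (simp add: word_op_def zero_fword_def)

lemma evaluate_one: "evaluate T 1 = 1"
  using evaluate_scal[of T 1] by (simp add: scal_one const_op_one)

lemma evaluate_gen: "evaluate T (gen g) = T g"
  unfolding gen_def evaluate_single by (simp add: word_op_def const_op_one)

lemma evaluate_mult: "evaluate T (p * q) = evaluate T p * evaluate T q"
proof (induction p rule: update_induct)
  case const
  show ?case by (simp add: evaluate_zero)
next
  case (update p v a)
  have "evaluate T (Poly_Mapping.single v a * q) = evaluate T (Poly_Mapping.single v a) * evaluate T q"
  proof (induction q rule: update_induct)
    case const
    show ?case by (simp add: evaluate_zero)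
  next
    case (update q w b)
    have "Poly_Mapping.update w b q = Poly_Mapping.single w b + q"
      using update.hyps
      by (intro poly_mapping_eqI) (auto simp: lookup_update lookup_add lookup_single when_def in_keys_iff)
    moreover have "evaluate T (Poly_Mapping.single v a * Poly_Mapping.single w b) =
        evaluate T (Poly_Mapping.single v a) * evaluate T (Poly_Mapping.single w b)"
    proof -
      have "word_op T (v + w) = word_op T v * word_op T w"
        by (simp add: word_op_def plus_fword_def)
      then have "evaluate T (Poly_Mapping.single v a * Poly_Mapping.single w b) =
          const_op a * (const_op b * word_op T v) * word_op T w"
        unfolding mult_single evaluate_single const_op_mult by (simp only: mult.assoc)
      also have "\<dots> = (const_op a * word_op T v) * (const_op b * word_op T w)"
        unfolding const_op_commute[of b "word_op T v"] by (simp only: mult.assoc)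
      finally show ?thesis unfolding evaluate_single .
    qed
    ultimately show ?case
      using update.IH by (simp only: distrib_left evaluate_add)
  qed
  moreover have "Poly_Mapping.update v a p = Poly_Mapping.single v a + p"
    using update.hyps
    by (intro poly_mapping_eqI) (auto simp: lookup_update lookup_add lookup_single when_def in_keys_iff)
  ultimately show ?case
    using update.IH by (simp only: distrib_right evaluate_add)
qed

lemma evaluate_diff: "evaluate T (p - q) = evaluate T p - evaluate T q"
  using evaluate_add[of T "p - q" q] by simp

lemma evaluate_power: "evaluate T (p ^ n) = evaluate T p ^ n"
  by (induction n) (simp_all add: evaluate_one evaluate_mult)

lemma evaluate_sum: "evaluate T (sum p F) = (\<Sum>k\<in>F. evaluate T (p k))"
  by (induction F rule: infinite_finite_induct) (simp_all add: evaluate_zero evaluate_add)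

lemmas evaluate_simps = evaluate_add evaluate_diff evaluate_mult evaluate_scal evaluate_gen
  evaluate_power evaluate_one

lemma range_evaluate_closed:
  assumes "s \<in> range (evaluate T)" "t \<in> range (evaluate T)"
  shows "s + t \<in> range (evaluate T)" "s * t \<in> range (evaluate T)"
  using assms by (auto simp: evaluate_add[symmetric] evaluate_mult[symmetric])

text \<open>
  The symbol at \<open>j\<close> isolates the terms with \<open>X\<^sup>j\<close>. These have the common factor \<open>z\<^sub>j\<close>, which
  cancels since polynomials form a domain, and what remains are distinct powers of \<open>h\<close>.
  The map \<open>e\<close> gives the exponents of \<open>h\<close> and \<open>X\<close>, which lets families with different index
  sets be treated alike.
\<close>

lemma independent_terms:
  fixes e :: "'k \<Rightarrow> nat \<times> int"
  assumes e: "inj e" and z: "\<And>j. z j \<noteq> 0" and F: "finite F" "k \<in> F"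
    and zero: "(\<Sum>k\<in>F. const_op (c k) *
      (poly_op lam ([:0, 1:] ^ fst (e k) * z (snd (e k))) * shift_op (snd (e k)))) = 0"
  shows "c k = 0"
proof -
  define i j where "i = fst (e k)" and "j = snd (e k)"
  have "0 = symbol (\<Sum>l\<in>F. const_op (c l) *
      (poly_op lam ([:0, 1:] ^ fst (e l) * z (snd (e l))) * shift_op (snd (e l)))) j"
    by (simp only: zero symbol_zero)
  also have "\<dots> = (\<Sum>l\<in>F. z j * (if snd (e l) = j then monom (c l) (fst (e l)) else 0))"
    unfolding symbol_sum symbol_const symbol_poly_shift
    by (rule sum.cong) (auto simp: monom_altdef mult.commute)
  also have "\<dots> = z j * (\<Sum>l\<in>F. if snd (e l) = j then monom (c l) (fst (e l)) else 0)"
    by (simp only: sum_distrib_left)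
  finally have "(\<Sum>l\<in>F. if snd (e l) = j then monom (c l) (fst (e l)) else 0) = 0"
    using z[of j] by simp
  then have "coeff (\<Sum>l\<in>F. if snd (e l) = j then monom (c l) (fst (e l)) else 0) i = 0"
    by simp
  moreover have "coeff (\<Sum>l\<in>F. if snd (e l) = j then monom (c l) (fst (e l)) else 0) i =
      (\<Sum>l\<in>F. if l = k then c l else 0)"
    unfolding coeff_sum
  proof (rule sum.cong[OF refl])
    fix l
    have "l = k \<longleftrightarrow> snd (e l) = j \<and> fst (e l) = i"
      using e by (metis i_def j_def injD prod_eqI)
    then show "coeff (if snd (e l) = j then monom (c l) (fst (e l)) else 0) i = (if l = k then c l else 0)"
      by auto
  qed
  ultimately show ?thesis using F by simp
qed

lemma poly_op_range_evaluate:
  assumes "poly_op lam [:0, 1:] \<in> range (evaluate T)"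
  shows "poly_op lam p \<in> range (evaluate T)"
proof (induction p)
  case 0
  show ?case using evaluate_zero[of T] by (metis poly_op_zero rangeI)
next
  case (pCons a p)
  have "pCons a p = [:a:] + [:0, 1:] * p" by simp
  then have "poly_op lam (pCons a p) = const_op a + poly_op lam [:0, 1:] * poly_op lam p"
    by (simp only: poly_op_add poly_op_mult poly_op_const)
  moreover have "const_op a \<in> range (evaluate T)" using evaluate_scal[of T a] by (metis rangeI)
  ultimately show ?case
    using assms pCons by (simp add: range_evaluate_closed)
qed

lemma skew_polys_subset_range_evaluate:
  assumes "poly_op lam [:0, 1:] \<in> range (evaluate T)" "shift_op 1 \<in> range (evaluate T)"
  shows "skew_polys lam \<subseteq> range (evaluate T)"
proof
  fix t assume "t \<in> skew_polys lam"
  then obtain n where "t \<in> skew_below lam n" by (auto simp: skew_polys_def)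
  then show "t \<in> range (evaluate T)"
  proof (induction rule: skew_below.induct)
    case zero
    show ?case using evaluate_zero[of T] by (metis rangeI)
  next
    case (step t j p)
    obtain q where "shift_op 1 = evaluate T q" using assms(2) by blast
    then have "shift_op (int j) = evaluate T (q ^ j)"
      using shift_op_power[of 1 j] by (simp add: evaluate_power)
    then show ?case
      using step(3) poly_op_range_evaluate[OF assms(1)] by (simp add: range_evaluate_closed)
  qed
qed

lemma commute_power_mod:
  assumes "g * h - scal a * h * g \<in> relation_ideal rels"
  shows "g * h ^ i - scal (a ^ i) * h ^ i * g \<in> relation_ideal rels"
proof (induction i)
  case 0
  show ?case by (simp add: scal_one relation_ideal_zero)
next
  case (Suc i)
  have "scal (a ^ i) * h ^ i * (scal a * h * g) = scal (a ^ i) * (h ^ i * scal a) * h * g"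
    by (simp only: mult.assoc)
  also have "h ^ i * scal a = scal a * h ^ i" by (rule scal_commute[symmetric])
  also have "scal (a ^ i) * (scal a * h ^ i) * h * g = scal (a ^ i * a) * (h ^ i * h) * g"
    by (simp only: scal_mult mult.assoc)
  also have "\<dots> = scal (a ^ Suc i) * h ^ Suc i * g"
    by (simp only: power_Suc2)
  finally have e: "scal (a ^ i) * h ^ i * (scal a * h * g) = scal (a ^ Suc i) * h ^ Suc i * g" .
  have "g * h ^ Suc i - scal (a ^ Suc i) * h ^ Suc i * g =
      (g * h ^ i - scal (a ^ i) * h ^ i * g) * h + scal (a ^ i) * h ^ i * (g * h - scal a * h * g)"
    unfolding right_diff_distrib e by (simp only: power_Suc2 left_diff_distrib mult.assoc) simp
  then show ?case
    using relation_ideal_add[OF relation_ideal_mult_right[OF Suc] relation_ideal_mult_left[OF assms]]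
    by simp
qed

section \<open>The quantum plane\<close>

fun plane_op :: "complex \<Rightarrow> plane_gen \<Rightarrow> operator" where
  "plane_op lam plane_gen.x = poly_op lam [:0, 1:]"
| "plane_op lam plane_gen.y = shift_op 1"

abbreviation plane_relations :: "complex \<Rightarrow> plane_gen free_alg set" where
  "plane_relations lam \<equiv>
    {gen plane_gen.y * gen plane_gen.x - scal lam * gen plane_gen.x * gen plane_gen.y}"

lemma plane_model:
  assumes lam: "lam \<noteq> 0"
  shows "faithful_model (plane_relations lam) (evaluate (plane_op lam))"
proof (rule faithful_modelI)
  let ?rels = "plane_relations lam"
  let ?x = "gen plane_gen.x" and ?y = "gen plane_gen.y"
  define M :: "nat \<times> nat \<Rightarrow> plane_gen free_alg" where "M = (\<lambda>(i, j). ?x ^ i * ?y ^ j)"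
  have "lam powi 1 = lam" by simp
  then have "evaluate (plane_op lam) (?y * ?x - scal lam * ?x * ?y) = 0"
    using poly_op_mult[of lam "[:lam:]" "[:0, 1:]"]
    by (simp add: evaluate_simps shift_poly_op[OF lam] dilate_pCons_0_1 poly_op_const)
  then show "evaluate (plane_op lam) r = 0" if "r \<in> ?rels" for r
    using that by simp
  show "1 \<in> spanned_mod ?rels M"
    using spanned_mod_base[of M "(0, 0)"] by (simp add: M_def)
  show "gen g * M k \<in> spanned_mod ?rels M" for g k
  proof -
    obtain i j where k: "k = (i, j)" by fastforce
    show ?thesis
    proof (cases g)
      case x
      have "gen g * M k = M (Suc i, j)" by (simp add: k x M_def mult.assoc)
      then show ?thesis by (simp only: spanned_mod_base)
    next
      case y
      have "?y * ?x ^ i - scal (lam ^ i) * ?x ^ i * ?y \<in> relation_ideal ?rels"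
        by (rule commute_power_mod) (simp add: relation_ideal_base)
      then have "(?y * ?x ^ i - scal (lam ^ i) * ?x ^ i * ?y) * ?y ^ j \<in> relation_ideal ?rels"
        by (rule relation_ideal_mult_right)
      then have "gen g * M k - scal (lam ^ i) * M (i, Suc j) \<in> relation_ideal ?rels"
        by (simp add: k y M_def left_diff_distrib mult.assoc)
      then show ?thesis
        by (rule spanned_mod_cong[OF spanned_mod_scal[OF spanned_mod_base]])
    qed
  qed
  show "c k = 0"
    if "finite F" "evaluate (plane_op lam) (\<Sum>k\<in>F. scal (c k) * M k) = 0" "k \<in> F" for F c k
  proof (rule independent_terms[of "\<lambda>(i, j). (i, int j)" "\<lambda>_. 1" F k c lam])
    show "inj (\<lambda>(i :: nat, j). (i, int j))" by (auto simp: inj_on_def)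
    have M: "evaluate (plane_op lam) (M k) = poly_op lam ([:0, 1:] ^ fst k) * shift_op (int (snd k))" for k
      by (simp add: M_def case_prod_unfold evaluate_simps poly_op_power shift_op_power)
    show "(\<Sum>k\<in>F. const_op (c k) * (poly_op lam ([:0, 1:] ^ fst (case k of (i, j) \<Rightarrow> (i, int j)) * 1) *
        shift_op (snd (case k of (i, j) \<Rightarrow> (i, int j))))) = 0"
      using that(2) by (simp add: evaluate_sum evaluate_mult evaluate_scal M case_prod_unfold)
  qed (use that in auto)
qed (simp_all add: evaluate_simps)

lemma range_plane:
  assumes lam: "lam \<noteq> 0"
  shows "range (evaluate (plane_op lam)) = skew_polys lam"
proof
  show "skew_polys lam \<subseteq> range (evaluate (plane_op lam))"
    by (rule skew_polys_subset_range_evaluate)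
      (metis evaluate_gen plane_op.simps(1) rangeI, metis evaluate_gen plane_op.simps(2) rangeI)
  have "evaluate (plane_op lam) p \<in> skew_polys lam" for p
  proof (induction p rule: free_alg_induct)
    case (gen g p)
    have "plane_op lam g \<in> skew_polys lam"
      using skew_polys_poly skew_polys_shift[of 1] by (cases g) auto
    with gen show ?case by (simp add: evaluate_simps skew_polys_mult[OF lam])
  next
    case (scal c p)
    have "const_op c \<in> skew_polys lam"
      using skew_polys_poly[of lam "[:c:]"] by (simp add: poly_op_const)
    with scal show ?case by (simp add: evaluate_simps skew_polys_mult[OF lam])
  next
    case zero
    show ?case using skew_polys_poly[of lam 0] by (simp add: evaluate_zero poly_op_zero)
  next
    case one
    show ?case using skew_polys_poly[of lam 1] by (simp add: evaluate_one poly_op_one)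
  qed (simp add: evaluate_add skew_polys_add)
  then show "range (evaluate (plane_op lam)) \<subseteq> skew_polys lam" by blast
qed

section \<open>The quantum sphere\<close>

text \<open>
  The relation for \<open>Y X\<close> forces \<open>Y = q(H) X\<^sup>-\<^sup>1\<close> with
  \<open>q(h) = - mu\<^sup>-\<^sup>1 (c - h) (d + h)\<close>.
\<close>

definition sphere_poly :: "complex \<Rightarrow> complex \<Rightarrow> complex \<Rightarrow> complex poly" where
  "sphere_poly mu c d = [:- inverse mu:] * ([:c, -1:] * [:d, 1:])"

fun sphere_op :: "complex \<Rightarrow> complex \<Rightarrow> complex \<Rightarrow> complex \<Rightarrow> sphere_gen \<Rightarrow> operator" where
  "sphere_op lam mu c d sphere_gen.H = poly_op lam [:0, 1:]"
| "sphere_op lam mu c d sphere_gen.X = shift_op 1"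
| "sphere_op lam mu c d sphere_gen.Y = poly_op lam (sphere_poly mu c d) * shift_op (- 1)"

lemma sphere_poly_nonzero: "mu \<noteq> 0 \<Longrightarrow> sphere_poly mu c d \<noteq> 0"
  by (simp add: sphere_poly_def)

lemma sphere_relations_hold:
  assumes lam: "lam \<noteq> 0" and mu: "mu \<noteq> 0" and r: "r \<in> sphere_relations lam mu c d"
  shows "evaluate (sphere_op lam mu c d) r = 0"
proof -
  let ?D = "poly_op lam" and ?h = "[:0, 1:] :: complex poly" and ?q = "sphere_poly mu c d"
  have C: "const_op b = ?D [:b:]" for b by (simp add: poly_op_const)
  have S: "shift_op 1 * shift_op (- 1) = 1" "shift_op (- 1) * shift_op 1 = 1"
    by (simp_all add: shift_op_add[symmetric] shift_op_zero)
  have XH: "shift_op 1 * ?D ?h = const_op lam * ?D ?h * shift_op 1"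
    using poly_op_mult[of lam "[:lam:]" ?h]
    by (simp add: shift_poly_op[OF lam] dilate_pCons_0_1 C)
  have YH: "(?D ?q * shift_op (- 1)) * ?D ?h = const_op (inverse lam) * ?D ?h * (?D ?q * shift_op (- 1))"
  proof -
    have "(?D ?q * shift_op (- 1)) * ?D ?h = ?D (?q * dilate lam (- 1) ?h) * shift_op (- 1)"
      by (simp only: mult.assoc shift_poly_op[OF lam] poly_op_mult)
    also have "?q * dilate lam (- 1) ?h = [:inverse lam:] * ?h * ?q"
      by (simp add: dilate_pCons_0_1 power_int_minus)
    finally show ?thesis by (simp only: C poly_op_mult mult.assoc)
  qed
  have YX: "const_op mu * (?D ?q * shift_op (- 1)) * shift_op 1 +
      (const_op c - ?D ?h) * (const_op d + ?D ?h) = 0"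
  proof -
    have "const_op c - ?D ?h = ?D ([:c:] + - ?h)" "const_op d + ?D ?h = ?D ([:d:] + ?h)"
      by (simp_all only: C poly_op_add poly_op_uminus) simp
    then have "const_op mu * (?D ?q * shift_op (- 1)) * shift_op 1 +
        (const_op c - ?D ?h) * (const_op d + ?D ?h) =
        ?D ([:mu:] * ?q + ([:c:] + - ?h) * ([:d:] + ?h))"
      by (simp only: C poly_op_add poly_op_mult mult.assoc S mult_1_right)
    also have "[:mu:] * ?q + ([:c:] + - ?h) * ([:d:] + ?h) = 0"
      using mu by (simp add: sphere_poly_def)
    finally show ?thesis by (simp only: poly_op_zero)
  qed
  have XY: "const_op mu * shift_op 1 * (?D ?q * shift_op (- 1)) +
      (const_op c - const_op lam * ?D ?h) * (const_op d + const_op lam * ?D ?h) = 0"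
  proof -
    have "const_op mu * shift_op 1 * (?D ?q * shift_op (- 1)) =
        const_op mu * (shift_op 1 * ?D ?q) * shift_op (- 1)"
      by (simp only: mult.assoc)
    also have "\<dots> = const_op mu * ?D (dilate lam 1 ?q) * (shift_op 1 * shift_op (- 1))"
      by (simp only: shift_poly_op[OF lam] mult.assoc)
    also have "\<dots> = ?D ([:mu:] * dilate lam 1 ?q)"
      by (simp only: S mult_1_right C poly_op_mult)
    finally have "const_op mu * shift_op 1 * (?D ?q * shift_op (- 1)) = ?D ([:mu:] * dilate lam 1 ?q)" .
    moreover have "const_op c - const_op lam * ?D ?h = ?D ([:c:] + - ([:lam:] * ?h))"
        "const_op d + const_op lam * ?D ?h = ?D ([:d:] + [:lam:] * ?h)"
      by (simp_all only: C poly_op_add poly_op_mult poly_op_uminus) simp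
    ultimately have "const_op mu * shift_op 1 * (?D ?q * shift_op (- 1)) +
        (const_op c - const_op lam * ?D ?h) * (const_op d + const_op lam * ?D ?h) =
        ?D ([:mu:] * dilate lam 1 ?q + ([:c:] + - ([:lam:] * ?h)) * ([:d:] + [:lam:] * ?h))"
      by (simp only: poly_op_add poly_op_mult)
    also have "[:mu:] * dilate lam 1 ?q + ([:c:] + - ([:lam:] * ?h)) * ([:d:] + [:lam:] * ?h) = 0"
      using mu
      by (simp add: sphere_poly_def dilate_def pcompose_mult pcompose_pCons) (simp add: field_simps)
    finally show ?thesis by (simp only: poly_op_zero)
  qed
  show ?thesis
    using r XH YH YX XY by (auto simp: sphere_relations_def evaluate_simps)
qed

text \<open>
  A negative exponent \<open>j\<close> stands for the power \<open>Y\<^sup>-\<^sup>j\<close>, whose operator is a polynomial in \<open>H\<close>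
  times \<open>X\<^sup>j\<close>. The second index is thus the exponent of \<open>X\<close> in the model.
\<close>

definition sphere_monomial :: "nat \<times> int \<Rightarrow> sphere_gen free_alg" where
  "sphere_monomial = (\<lambda>(i, j). gen sphere_gen.H ^ i *
     (if j \<ge> 0 then gen sphere_gen.X ^ nat j else gen sphere_gen.Y ^ nat (- j)))"

text \<open>
  The letters \<open>X\<close> and \<open>Y\<close> move past powers of \<open>H\<close> at the cost of a scalar, and where \<open>X\<close> then
  meets \<open>Y\<close> the product is quadratic in \<open>H\<close>; so no monomial mixing \<open>X\<close> and \<open>Y\<close> survives.
\<close>

lemma sphere_monomials_span:
  assumes lam: "lam \<noteq> 0" and mu: "mu \<noteq> 0"
  shows "gen g * sphere_monomial k \<in> spanned_mod (sphere_relations lam mu c d) sphere_monomial"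
proof -
  let ?rels = "sphere_relations lam mu c d"
  let ?N = "spanned_mod ?rels sphere_monomial"
  let ?X = "gen sphere_gen.X" and ?Y = "gen sphere_gen.Y" and ?H = "gen sphere_gen.H"
  note M_def = sphere_monomial_def
  have base: "?X * ?H - scal lam * ?H * ?X \<in> relation_ideal ?rels"
      "?Y * ?H - scal (inverse lam) * ?H * ?Y \<in> relation_ideal ?rels"
      "scal mu * ?Y * ?X + (scal c - ?H) * (scal d + ?H) \<in> relation_ideal ?rels"
      "scal mu * ?X * ?Y + (scal c - scal lam * ?H) * (scal d + scal lam * ?H) \<in> relation_ideal ?rels"
    by (simp_all add: relation_ideal_base sphere_relations_def)
  have H: "?H * p \<in> ?N" if "p \<in> ?N" for p
  proof (rule spanned_mod_left_mult[OF _ that])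
    fix k :: "nat \<times> int"
    have "?H * sphere_monomial k = sphere_monomial (Suc (fst k), snd k)"
      by (simp add: M_def case_prod_unfold mult.assoc)
    then show "?H * sphere_monomial k \<in> ?N" by (simp only: spanned_mod_base)
  qed
  have Hi: "?H ^ i * p \<in> ?N" if "p \<in> ?N" for p i
    using that by (induction i) (simp_all add: H mult.assoc)
  \<comment> \<open>A product \<open>X Y\<close> or \<open>Y X\<close> is a quadratic polynomial in \<open>H\<close>.\<close>
  have quadratic: "u * p \<in> ?N"
    if "scal mu * u + (scal a - scal b * ?H) * (scal e + scal b * ?H) \<in> relation_ideal ?rels" "p \<in> ?N"
    for u p a b e
  proof -
    let ?P = "(scal a - scal b * ?H) * (scal e + scal b * ?H)"
    have lin: "(scal e + scal b * ?H) * p \<in> ?N" if "p \<in> ?N" for p b e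
      using that by (simp add: distrib_right mult.assoc spanned_mod_add spanned_mod_scal H)
    have "(scal a + scal (- b) * ?H) * ((scal e + scal b * ?H) * p) \<in> ?N"
      by (intro lin \<open>p \<in> ?N\<close>)
    then have "?P * p \<in> ?N" by (simp add: scal_uminus mult.assoc)
    then have "scal (- inverse mu) * (?P * p) \<in> ?N" by (rule spanned_mod_scal)
    moreover have "scal (inverse mu) * (scal mu * u + ?P) * p \<in> relation_ideal ?rels"
      using that(1) by (intro relation_ideal_mult_left relation_ideal_mult_right)
    moreover have "scal (inverse mu) * (scal mu * u + ?P) * p = u * p - scal (- inverse mu) * (?P * p)"
    proof -
      have "scal (inverse mu) * (scal mu * u) = u"
        using mu by (simp add: mult.assoc[symmetric] scal_mult[symmetric] scal_one)
      then show ?thesis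
        by (simp only: distrib_left distrib_right scal_uminus mult.assoc) simp
    qed
    ultimately show ?thesis by (metis spanned_mod_cong)
  qed
  have YX: "?Y * ?X * p \<in> ?N" if "p \<in> ?N" for p
    using quadratic[of "?Y * ?X" c 1 d p] base(3) that by (simp add: scal_one mult.assoc)
  have XY: "?X * ?Y * p \<in> ?N" if "p \<in> ?N" for p
    using quadratic[of "?X * ?Y" c lam d p] base(4) that by (simp add: mult.assoc)
  obtain i j where k: "k = (i, j)" by fastforce
  let ?Z = "sphere_monomial (0, j)"
  have M: "sphere_monomial k = ?H ^ i * ?Z" by (simp add: M_def k)
  have past_H: "u * (?H ^ i * ?Z) \<in> ?N"
    if "u * ?H - scal a * ?H * u \<in> relation_ideal ?rels" "u * ?Z \<in> ?N" for u a
  proof -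
    have "(u * ?H ^ i - scal (a ^ i) * ?H ^ i * u) * ?Z \<in> relation_ideal ?rels"
      by (intro relation_ideal_mult_right commute_power_mod that(1))
    then have "u * (?H ^ i * ?Z) - scal (a ^ i) * (?H ^ i * (u * ?Z)) \<in> relation_ideal ?rels"
      by (simp only: left_diff_distrib mult.assoc)
    then show ?thesis
      by (rule spanned_mod_cong[OF spanned_mod_scal[OF Hi[OF that(2)]]])
  qed
  have XZ: "?X * ?Z \<in> ?N"
  proof (cases "j \<ge> 0")
    case True
    then have "?X * ?Z = sphere_monomial (0, j + 1)" by (simp add: M_def nat_add_distrib)
    then show ?thesis by (simp only: spanned_mod_base)
  next
    case False
    then have "nat (- j) = Suc (nat (- (j + 1)))" by simp
    then have "?X * ?Z = ?X * ?Y * sphere_monomial (0, j + 1)"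
      using False by (auto simp: M_def mult.assoc)
    then show ?thesis using XY[OF spanned_mod_base] by simp
  qed
  have YZ: "?Y * ?Z \<in> ?N"
  proof (cases "j \<le> 0")
    case True
    then have "nat (- (j - 1)) = Suc (nat (- j))" by simp
    then have "?Y * ?Z = sphere_monomial (0, j - 1)" using True by (auto simp: M_def)
    then show ?thesis by (simp only: spanned_mod_base)
  next
    case False
    then have "nat j = Suc (nat (j - 1))" by simp
    then have "?Y * ?Z = ?Y * ?X * sphere_monomial (0, j - 1)"
      using False by (auto simp: M_def mult.assoc)
    then show ?thesis using YX[OF spanned_mod_base] by simp
  qed
  show ?thesis
  proof (cases g)
    case X
    then show ?thesis using past_H[OF base(1) XZ] M by simp
  next
    case Y
    then show ?thesis using past_H[OF base(2) YZ] M by simp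
  next
    case H
    then show ?thesis using \<open>\<And>p. p \<in> ?N \<Longrightarrow> ?H * p \<in> ?N\<close>[OF spanned_mod_base] by simp
  qed
qed

lemma sphere_Y_power:
  assumes lam: "lam \<noteq> 0" and mu: "mu \<noteq> 0"
  shows "\<exists>z. z \<noteq> 0 \<and> sphere_op lam mu c d sphere_gen.Y ^ n = poly_op lam z * shift_op (- int n)"
proof (induction n)
  case 0
  show ?case by (intro exI[of _ 1]) (simp add: poly_op_one shift_op_zero)
next
  case (Suc n)
  then obtain z where z: "z \<noteq> 0"
      "sphere_op lam mu c d sphere_gen.Y ^ n = poly_op lam z * shift_op (- int n)"
    by blast
  show ?case
    using z(1) sphere_poly_nonzero[OF mu]
    by (intro exI[of _ "sphere_poly mu c d * dilate lam (- 1) z"])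
      (simp add: z(2)[simplified] poly_shift_mult[OF lam] dilate_eq_0_iff[OF lam])
qed

lemma sphere_model:
  assumes lam: "lam \<noteq> 0" and mu: "mu \<noteq> 0"
  shows "faithful_model (sphere_relations lam mu c d) (evaluate (sphere_op lam mu c d))"
proof (rule faithful_modelI[where M = sphere_monomial])
  show "1 \<in> spanned_mod (sphere_relations lam mu c d) sphere_monomial"
    using spanned_mod_base[of sphere_monomial "(0, 0)"] by (simp add: sphere_monomial_def)
  have "\<exists>z. z \<noteq> 0 \<and> evaluate (sphere_op lam mu c d) (sphere_monomial (0, j)) = poly_op lam z * shift_op j" for j
  proof (cases "j \<ge> 0")
    case True
    then show ?thesis
      by (intro exI[of _ 1]) (simp add: sphere_monomial_def evaluate_simps shift_op_power poly_op_one)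
  next
    case False
    then show ?thesis
      using sphere_Y_power[OF lam mu, of c d "nat (- j)"]
      by (simp add: sphere_monomial_def evaluate_simps)
  qed
  then obtain z where z: "\<And>j. z j \<noteq> 0"
    "\<And>j. evaluate (sphere_op lam mu c d) (sphere_monomial (0, j)) = poly_op lam (z j) * shift_op j"
    by metis
  have M: "evaluate (sphere_op lam mu c d) (sphere_monomial k) =
      poly_op lam ([:0, 1:] ^ fst k * z (snd k)) * shift_op (snd k)" for k
  proof -
    have "sphere_monomial k = gen sphere_gen.H ^ fst k * sphere_monomial (0, snd k)"
      by (simp add: sphere_monomial_def case_prod_unfold)
    then show ?thesis
      by (simp add: evaluate_mult z(2) poly_op_mult mult.assoc) (simp add: evaluate_simps poly_op_power)
  qed
  show "e k = 0"
    if "finite F" "evaluate (sphere_op lam mu c d) (\<Sum>k\<in>F. scal (e k) * sphere_monomial k) = 0" "k \<in> F"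
    for F e k
    by (rule independent_terms[of "\<lambda>k. k" z F k e lam])
      (use that z(1) in \<open>simp_all add: evaluate_sum evaluate_mult evaluate_scal M\<close>)
qed (use sphere_relations_hold[OF lam mu] sphere_monomials_span[OF lam mu] in
    \<open>simp_all add: evaluate_simps\<close>)

lemma skew_polys_conjugate:
  assumes lam: "lam \<noteq> 0" and t: "t \<in> skew_polys lam"
  shows "shift_op j * t * shift_op (- j) \<in> skew_polys lam"
proof -
  obtain n where "t \<in> skew_below lam n" using t by (auto simp: skew_polys_def)
  then show ?thesis
  proof (induction rule: skew_below.induct)
    case zero
    show ?case using skew_polys_poly[of lam 0] by (simp add: poly_op_zero)
  next
    case (step t i p)
    have "shift_op j * (poly_op lam p * shift_op (int i)) * shift_op (- j) =
        (shift_op j * poly_op lam p) * (shift_op (int i) * shift_op (- j))"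
      by (simp only: mult.assoc)
    also have "\<dots> = poly_op lam (dilate lam j p) * (shift_op j * (shift_op (int i) * shift_op (- j)))"
      by (simp only: shift_poly_op[OF lam] mult.assoc)
    also have "\<dots> = poly_op lam (dilate lam j p) * shift_op (int i)"
      by (simp add: shift_op_add[symmetric])
    finally have "shift_op j * (poly_op lam p * shift_op (int i)) * shift_op (- j) \<in> skew_polys lam"
      by (simp only: skew_polys_term)
    then show ?case using step(3) by (simp add: distrib_left distrib_right skew_polys_add)
  qed
qed

text \<open>
  A power of \<open>X\<close> on the right removes the negative powers of \<open>X\<close>. A new factor
  \<open>Y = q(H) X\<^sup>-\<^sup>1\<close> on the left is compensated by one more \<open>X\<close> on the right, because
  conjugation by \<open>X\<close> preserves the skew polynomials.
\<close>

lemma sphere_clears: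
  assumes lam: "lam \<noteq> 0"
  shows "\<exists>n. evaluate (sphere_op lam mu c d) p * shift_op (int n) \<in> skew_polys lam"
proof (induction p rule: free_alg_induct)
  case zero
  show ?case using skew_polys_poly[of lam 0] by (simp add: evaluate_zero poly_op_zero)
next
  case (add p q)
  let ?e = "evaluate (sphere_op lam mu c d)"
  obtain m n where mn: "?e p * shift_op (int m) \<in> skew_polys lam" "?e q * shift_op (int n) \<in> skew_polys lam"
    using add by blast
  have "?e p * shift_op (int (m + n)) \<in> skew_polys lam"
    using skew_polys_mult[OF lam mn(1) skew_polys_shift[of n]] by (simp add: shift_op_add mult.assoc)
  moreover have "?e q * shift_op (int (m + n)) \<in> skew_polys lam"
    using skew_polys_mult[OF lam mn(2) skew_polys_shift[of m]]
    by (simp add: shift_op_add[symmetric] mult.assoc add.commute)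
  ultimately show ?case
    by (intro exI[of _ "m + n"]) (simp only: evaluate_add distrib_right skew_polys_add)
next
  case (scal a p)
  then obtain n where "evaluate (sphere_op lam mu c d) p * shift_op (int n) \<in> skew_polys lam" by blast
  then show ?case
    using skew_polys_mult[OF lam skew_polys_poly[of lam "[:a:]"]]
    by (intro exI[of _ n]) (simp add: evaluate_simps poly_op_const mult.assoc)
next
  case one
  show ?case using skew_polys_poly[of lam 1] by (intro exI[of _ 0]) (simp add: evaluate_one shift_op_zero poly_op_one)
next
  case (gen g p)
  let ?t = "evaluate (sphere_op lam mu c d) p"
  obtain n where n: "?t * shift_op (int n) \<in> skew_polys lam" using gen by blast
  show ?case
  proof (cases g)
    case X
    then show ?thesis
      using skew_polys_mult[OF lam skew_polys_shift[of 1] n]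
      by (intro exI[of _ n]) (simp add: evaluate_simps mult.assoc)
  next
    case H
    then show ?thesis
      using skew_polys_mult[OF lam skew_polys_poly[of lam "[:0, 1:]"] n]
      by (intro exI[of _ n]) (simp add: evaluate_simps mult.assoc)
  next
    case Y
    have "shift_op (- 1) * (?t * shift_op (int n)) * shift_op 1 \<in> skew_polys lam"
      using skew_polys_conjugate[OF lam n, of "- 1"] by simp
    then have "poly_op lam (sphere_poly mu c d) * (shift_op (- 1) * (?t * shift_op (int n)) * shift_op 1)
        \<in> skew_polys lam"
      by (rule skew_polys_mult[OF lam skew_polys_poly])
    moreover have "shift_op (int (n + 1)) = shift_op (int n) * shift_op 1"
      by (simp add: shift_op_add[symmetric] add.commute)
    ultimately have "evaluate (sphere_op lam mu c d) (gen g * p) * shift_op (int (n + 1)) \<in> skew_polys lam"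
      by (simp add: Y evaluate_simps mult.assoc)
    then show ?thesis by blast
  qed
qed

text \<open>
  Clearing powers of \<open>X\<close> on either side, invertibly, turns zero divisors of the sphere into
  zero divisors among the skew polynomials.
\<close>

lemma sphere_domain:
  assumes lam: "lam \<noteq> 0"
    and a: "a \<in> range (evaluate (sphere_op lam mu c d))"
    and b: "b \<in> range (evaluate (sphere_op lam mu c d))"
    and ab: "a * b = 0"
  shows "a = 0 \<or> b = 0"
proof -
  obtain m where m: "a * shift_op (int m) \<in> skew_polys lam" using a sphere_clears[OF lam] by blast
  obtain n where n: "b * shift_op (int n) \<in> skew_polys lam" using b sphere_clears[OF lam] by blast
  have inv: "shift_op (int m) * shift_op (- int m) = 1" "shift_op (- int m) * shift_op (int m) = 1"
      "shift_op (int n) * shift_op (- int n) = 1"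
    by (simp_all add: shift_op_add[symmetric] shift_op_zero)
  have "shift_op (int m) * (a * shift_op (int m)) * shift_op (- int m) = shift_op (int m) * a"
    by (simp add: mult.assoc inv)
  then have "shift_op (int m) * a \<in> skew_polys lam"
    using skew_polys_conjugate[OF lam m, of "int m"] by simp
  moreover have "(shift_op (int m) * a) * (b * shift_op (int n)) = 0"
    using ab by (metis mult.assoc mult_zero_left mult_zero_right)
  ultimately have "shift_op (int m) * a = 0 \<or> b * shift_op (int n) = 0"
    using skew_mult_nonzero[OF lam _ n] by blast
  then show ?thesis
  proof
    assume "shift_op (int m) * a = 0"
    then have "shift_op (- int m) * shift_op (int m) * a = 0" by (simp only: mult.assoc mult_zero_right)
    then show ?thesis by (simp add: inv)
  next
    assume "b * shift_op (int n) = 0"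
    then have "b * (shift_op (int n) * shift_op (- int n)) = 0" by (simp only: mult.assoc[symmetric] mult_zero_left)
    then show ?thesis by (simp add: inv)
  qed
qed

theorem corollary1:
  fixes lam mu c d :: complex
  assumes "lam \<noteq> 0"
    and "\<And>n::nat. n > 0 \<Longrightarrow> lam ^ n \<noteq> 1"
    and "mu\<^sup>2 = lam"
  shows "right_ore_domain (quantum_sphere lam mu c d) \<and>
         right_ore_domain (quantum_plane lam) \<and>
         Frac (quantum_sphere lam mu c d) \<cong>\<^sub>a\<^sub>l\<^sub>g Frac (quantum_plane lam)"
proof -
  note lam = assms(1)
  have mu: "mu \<noteq> 0" using assms(1,3) by auto
  let ?f = "evaluate (plane_op lam)" and ?g = "evaluate (sphere_op lam mu c d)"
  define \<phi> where "\<phi> = (\<lambda>C. {q. \<exists>p\<in>C. ?g q = ?f p})"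
  have "clearing_embedding (presented_algebra (plane_relations lam))
      (presented_algebra (sphere_relations lam mu c d)) \<phi>"
    unfolding \<phi>_def
  proof (rule clearing_embedding_of_models[OF plane_model[OF lam] sphere_model[OF lam mu]])
    show "?f (scal a) = ?g (scal a)" for a by (simp add: evaluate_scal)
    show "range ?f \<subseteq> range ?g"
      unfolding range_plane[OF lam]
      by (rule skew_polys_subset_range_evaluate)
        (metis evaluate_gen sphere_op.simps(1) rangeI, metis evaluate_gen sphere_op.simps(2) rangeI)
    show "a = 0 \<or> b = 0" if "a \<in> range ?g" "b \<in> range ?g" "a * b = 0" for a b
      using sphere_domain[OF lam] that by blast
    show "\<exists>u\<in>range ?f. \<exists>v\<in>range ?f. a * u = b * v \<and> a * u \<noteq> 0"
      if "a \<in> range ?f" "b \<in> range ?f" "a \<noteq> 0" "b \<noteq> 0" for a b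
      using skew_ore[OF lam] that unfolding range_plane[OF lam] by blast
    show "\<exists>r\<in>range ?f. r \<noteq> 0 \<and> a * r \<in> range ?f" if a: "a \<in> range ?g" for a
    proof -
      obtain n where "a * shift_op (int n) \<in> skew_polys lam"
        using a sphere_clears[OF lam] by blast
      moreover have "shift_op (int n) \<noteq> 0"
        using skew_leading_term_nonzero[OF skew_below.zero, of 1 lam n] by (simp add: poly_op_one)
      ultimately show ?thesis
        unfolding range_plane[OF lam] using skew_polys_shift by blast
    qed
  qed
  then interpret clearing_embedding "quantum_plane lam" "quantum_sphere lam mu c d" \<phi>
    unfolding quantum_plane_def quantum_sphere_def .
  show ?thesis
    using S_right_ore_domain R.right_ore_domain_axioms Frac_isomorphic by blast
qed

end
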